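(* Let $d\ge 2$, $0<\sigma<1/2$, $R>1$ and $p=\frac{2(d+1)}{d-1}$, and let $g$ be the function defined in the context. Let $X$ be the $1$-neighborhood of $$\{(n_1R^{\sigma},n_2R^{\sigma},\ldots,n_{d-1}R^{\sigma},n_dR^{2\sigma}) : n_1,\ldots,n_d\in\mathbb{Z}\}\cap B_R .$$ Then $g$ together with $X$ is an (almost) sharp example for the refined decoupling theorem recalled in the context. More precisely, let $M$ be the relevant bound in that theorem for $v=g$, i.e. each $x\in X$ hits the essential support of $\le M$ wave packets of $g$. Then $M\lesssim R^{(d-1)\sigma}$, and in fact $M\sim R^{(d-1)\sigma}$. Moreover $$\|g\|_{L^p(X)}\sim R^{(d-1)(\sigma-1)}|X|^{1/p}\sim R^{\frac{d-1}{2}\sigma-\frac{(d-1)(d+2)}{2(d+1)}},$$ while the right hand side of the refined decoupling inequality for $v=g$ satisfies $$R^{\varepsilon}M^{\frac12-\frac1p}\Big(\sum_\theta\|g_\theta\|_{L^p(w_{B_R})}^p\Big)^{1/p}\sim R^{\frac{d-1}{2}\sigma-\frac{(d-1)(d+2)}{2(d+1)}+\varepsilon}.$$ Thus the two sides of the refined decoupling inequality for $v=g$ match except for the $R^{\varepsilon}$-loss.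
   Context: Write $\xi=(\xi',\xi_d)\in\mathbb{R}^{d-1}\times\mathbb{R}$. The truncated paraboloid is $P^{d-1}=\{\xi\in\mathbb{R}^d:\ \xi_d=|\xi'|^2,\ |\xi_j|\le 1 \text{ for } 1\le j\le d-1\}$, and $\mathrm{d}\omega$ is the hypersurface measure on it. $B_R\subset\mathbb{R}^d$ is the ball of radius $R$ centered at the origin. $\lesssim$ and $\sim$ denote inequality and comparability up to constants independent of $R$. The function $g$ (the free Schrödinger solution of Barceló–Bennett–Carbery–Ruiz–Vilela): $\hat g=h\,\mathrm{d}\omega$, where the Fourier transform is normalized so that $g(x)=\int e^{2\pi i x\cdot\xi}h(\xi)\,\mathrm{d}\omega(\xi)$, and $h$, a function of $\xi'$, is $$h(\xi)=\sum_{\substack{l_1,\ldots,l_{d-1}\in\mathbb{Z}\\ 1\le l_1,\ldots,l_{d-1}<R^{\sigma}}}1_{(l_1R^{-\sigma}-R^{-1},\,l_1R^{-\sigma}+R^{-1})\times\cdots\times(l_{d-1}R^{-\sigma}-R^{-1},\,l_{d-1}R^{-\sigma}+R^{-1})}.$$ Wave packet decomposition: decompose $P^{d-1}$ into pieces $\theta$ whose projections to the first $d-1$ coordinates are cubes of side length $R^{-1/2}$. Each $\theta$ lies in a box of dimensions $R^{-1/2}\times\cdots\times R^{-1/2}\times R^{-1}$; let $T_\theta$ be the dual box centered at the origin (roughly a tube of thickness $R^{1/2}$ and length $R$), and let $\mathbb{T}_\theta$ be a family of translates of $T_\theta$ tiling $B_R$. A function $v$ with Fourier support in $P^{d-1}$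 can be decomposed inside $B_R$ as $v=\sum_{\theta}\sum_{T\in\mathbb{T}_\theta}v_{\theta,T}$, where each wave packet $v_{\theta,T}$ has Fourier transform supported in a box of dimensions $\sim R^{-1/2}\times\cdots\times R^{-1/2}\times R^{-1}$ containing $\theta$, is essentially supported in $T$ and rapidly decays outside it, and $|v_{\theta,T}|$ is essentially constant on $T$ (this constant is the magnitude of the wave packet); different wave packets are essentially $L^2$-orthogonal on every $R^{1/2}$-ball. Put $v_\theta=\sum_{T\in\mathbb{T}_\theta}v_{\theta,T}$. Refined decoupling theorem: suppose $\operatorname{supp}\hat v\subset P^{d-1}$, $R>1$, and any two wave packets of $v$ in $B_R$ have comparable magnitudes. Let $X\subset B_R$ be such that each $x\in X$ hits the essential support of $\le M$ wave packets. Then for $p=\frac{2(d+1)}{d-1}$, $$\|v\|_{L^p(X)}\lesssim_\varepsilon R^{\varepsilon}M^{\frac12-\frac1p}\Big(\sum_\theta\|v_\theta\|^p_{L^p(w_{B_R})}\Big)^{1/p}.$$ Here $w_{B_R}$ is a weight that behaves like $1_{B_R}$ but has a rapidly decaying tail. *)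

theory Defs
  imports "HOL-Analysis.Analysis"
begin

text \<open>
  Points of \<open>\<real>\<^sup>d\<close> are pairs \<open>(\<xi>', \<xi>\<^sub>d)\<close> of type \<open>(real ^ 'n) \<times> real\<close>, so that \<open>d = CARD('n) + 1\<close>.
  As index types are nonempty, \<open>d\<close> runs through all integers \<open>\<ge> 2\<close>.
\<close>

type_synonym 'n pt = "(real ^ 'n) \<times> real"

text \<open>Comparability up to the constant \<open>C\<close> (used for nonnegative quantities only).\<close>

definition comparable :: "real \<Rightarrow> real \<Rightarrow> real \<Rightarrow> bool" where
  "comparable C a b \<longleftrightarrow> a \<le> C * b \<and> b \<le> C * a"

definition Lp_norm :: "real \<Rightarrow> 'a measure \<Rightarrow> ('a \<Rightarrow> complex) \<Rightarrow> real" where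
  "Lp_norm p N f = (LINT x|N. norm (f x) powr p) powr (1 / p)"


section \<open>The truncated paraboloid\<close>

definition paraboloid :: "'n::finite pt set" where
  "paraboloid = {\<xi>. snd \<xi> = (norm (fst \<xi>))\<^sup>2 \<and> (\<forall>j. \<bar>fst \<xi> $ j\<bar> \<le> 1)}"

text \<open>
  The surface measure of the graph of \<open>\<phi>(\<xi>') = \<bar>\<xi>'\<bar>\<^sup>2\<close>: the image of
  \<open>sqrt (1 + \<bar>\<nabla>\<phi>\<bar>\<^sup>2) d\<xi>'\<close> under \<open>\<xi>' \<mapsto> (\<xi>', \<phi>(\<xi>'))\<close>, where \<open>\<nabla>\<phi>(\<xi>') = 2 \<xi>'\<close>.
\<close>

definition surface_measure :: "'n::finite pt measure" where
  "surface_measure =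
     distr
       (density lborel
         (\<lambda>\<xi>' :: real ^ 'n. ennreal (indicator {\<xi>'. \<forall>j. \<bar>\<xi>' $ j\<bar> \<le> 1} \<xi>' * sqrt (1 + (norm (2 *\<^sub>R \<xi>'))\<^sup>2))))
       borel (\<lambda>\<xi>'. (\<xi>', (norm \<xi>')\<^sup>2))"

text \<open>The function whose Fourier transform is \<open>f d\<omega>\<close>.\<close>

definition extension :: "('n::finite pt \<Rightarrow> real) \<Rightarrow> 'n pt \<Rightarrow> complex" where
  "extension f x = (LINT \<xi>|surface_measure. cis (2 * pi * (x \<bullet> \<xi>)) * complex_of_real (f \<xi>))"


section \<open>The example\<close>

definition h_fun :: "real \<Rightarrow> real \<Rightarrow> 'n::finite pt \<Rightarrow> real" where
  "h_fun \<sigma> R \<xi> =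
     (\<Sum>l \<in> {l :: int ^ 'n. \<forall>j. 1 \<le> l $ j \<and> real_of_int (l $ j) < R powr \<sigma>}.
        indicator
          (box (\<chi> j. real_of_int (l $ j) * R powr (- \<sigma>) - 1 / R)
               (\<chi> j. real_of_int (l $ j) * R powr (- \<sigma>) + 1 / R))
          (fst \<xi>))"

definition g_fun :: "real \<Rightarrow> real \<Rightarrow> 'n::finite pt \<Rightarrow> complex" where
  "g_fun \<sigma> R = extension (h_fun \<sigma> R)"

definition lattice :: "real \<Rightarrow> real \<Rightarrow> 'n::finite pt set" where
  "lattice \<sigma> R =
     {((\<chi> j. real_of_int (m $ j) * R powr \<sigma>), real_of_int k * R powr (2 * \<sigma>)) | (m :: int ^ 'n) (k :: int). True}"

definition X_set :: "real \<Rightarrow> real \<Rightarrow> 'n::finite pt set" where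
  "X_set \<sigma> R = (\<Union>y \<in> lattice \<sigma> R \<inter> ball 0 R. ball y 1)"


section \<open>Wave packets\<close>

text \<open>
  A cap \<open>\<theta>\<close> is indexed by the centre \<open>c\<close> of its projection, a half-open cube of side \<open>R\<^bsup>-1/2\<^esup>\<close>.
\<close>

definition cap_cube :: "real \<Rightarrow> real ^ 'n::finite \<Rightarrow> (real ^ 'n) set" where
  "cap_cube R c =
     {\<xi>'. \<forall>j. c $ j - R powr (- 1 / 2) / 2 \<le> \<xi>' $ j \<and> \<xi>' $ j < c $ j + R powr (- 1 / 2) / 2}"

definition cap :: "real \<Rightarrow> real ^ 'n::finite \<Rightarrow> 'n pt set" where
  "cap R c = {\<xi> \<in> paraboloid. fst \<xi> \<in> cap_cube R c}"

definition unit_box :: "'n::finite pt set" where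
  "unit_box = {z. (\<forall>j. - 1 / 2 \<le> fst z $ j \<and> fst z $ j < 1 / 2) \<and> - 1 / 2 \<le> snd z \<and> snd z < 1 / 2}"

text \<open>
  For an orthogonal map \<open>U\<close>, the image of \<open>unit_box\<close> under \<open>frame U r s\<close> is the box centred at the
  origin whose axes are the \<open>U\<close>-images of the coordinate axes, with side lengths \<open>r, \<dots>, r, s\<close>.
\<close>

definition frame :: "('n::finite pt \<Rightarrow> 'n pt) \<Rightarrow> real \<Rightarrow> real \<Rightarrow> 'n pt \<Rightarrow> 'n pt" where
  "frame U r s z = U (r *\<^sub>R fst z, s * snd z)"

text \<open>
  The box of dimensions \<open>A R\<^bsup>-1/2\<^esup>, \<dots>, A R\<^bsup>-1/2\<^esup>, A R\<^bsup>-1\<^esup>\<close> around a cap, centred at the point of the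
  paraboloid above \<open>c\<close>, and the dual box centred at the origin, which has the same axes and reciprocal
  side lengths.
\<close>

definition cap_box :: "real \<Rightarrow> real \<Rightarrow> ('n::finite pt \<Rightarrow> 'n pt) \<Rightarrow> real ^ 'n \<Rightarrow> 'n pt set" where
  "cap_box A R U c = (\<lambda>z. (c, (norm c)\<^sup>2) + frame U (A * R powr (- 1 / 2)) (A / R) z) ` unit_box"

definition tube :: "real \<Rightarrow> real \<Rightarrow> ('n::finite pt \<Rightarrow> 'n pt) \<Rightarrow> 'n pt set" where
  "tube A R U = frame U (R powr (1 / 2) / A) (R / A) ` unit_box"

text \<open>
  The data of a wave packet decomposition at scale \<open>R\<close>, with implied constants \<open>A\<close> and \<open>D 0, D 1, \<dots>\<close>:
  \<^item> the set \<open>\<Theta>\<close> of (centres of) caps;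
  \<^item> for each cap \<open>c\<close> the frame \<open>U c\<close> of its box, whose last axis is normal to the paraboloid above \<open>c\<close>;
  \<^item> the set \<open>V c\<close> of those translations \<open>\<tau>\<close> for which the tubes \<open>T = \<tau> + T\<^sub>\<theta>\<close> form a tiling;
  \<^item> a partition of unity \<open>\<eta> c \<tau>\<close> subordinate to the tiling: \<open>\<eta> c \<tau>\<close> has Fourier support in the
    \<open>O(1)\<close>-dilate of the (recentred) box of the cap, is \<open>\<sim> 1\<close> on \<open>T\<close> and decays rapidly away from \<open>T\<close>
    (distances measured in the frame of \<open>T\<close>, relative to its dimensions).

  The tubes tile the whole space, not only \<open>B\<^sub>R\<close>: finitely many rapidly decaying functions of compact
  Fourier support cannot sum to \<open>1\<close> on a ball, since the sum is analytic.
\<close>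

definition wave_packet_system ::
  "real \<Rightarrow> (nat \<Rightarrow> real) \<Rightarrow> real \<Rightarrow> (real ^ 'n::finite) set \<Rightarrow> (real ^ 'n \<Rightarrow> 'n pt \<Rightarrow> 'n pt) \<Rightarrow>
   (real ^ 'n \<Rightarrow> 'n pt set) \<Rightarrow> (real ^ 'n \<Rightarrow> 'n pt \<Rightarrow> 'n pt \<Rightarrow> complex) \<Rightarrow> bool" where
  "wave_packet_system A D R \<Theta> U V \<eta> \<longleftrightarrow>
     disjoint_family_on (cap_cube R) \<Theta> \<and>
     {\<xi>'. \<forall>j. \<bar>\<xi>' $ j\<bar> \<le> 1} \<subseteq> (\<Union>c\<in>\<Theta>. cap_cube R c) \<and>
     (\<forall>c\<in>\<Theta>. cap R c \<noteq> {} \<and>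
        orthogonal_transformation (U c) \<and>
        U c (0, 1) = (1 / norm (- 2 *\<^sub>R c, 1::real)) *\<^sub>R (- 2 *\<^sub>R c, 1) \<and>
        cap R c \<subseteq> cap_box A R (U c) c \<and>
        disjoint_family_on (\<lambda>\<tau>. (+) \<tau> ` tube A R (U c)) (V c) \<and>
        (\<Union>\<tau>\<in>V c. (+) \<tau> ` tube A R (U c)) = UNIV \<and>
        (\<forall>x. ((\<lambda>\<tau>. \<eta> c \<tau> x) has_sum 1) (V c)) \<and>
        (\<forall>\<tau>\<in>V c.
           continuous_on UNIV (\<eta> c \<tau>) \<and>
           (\<forall>x \<in> (+) \<tau> ` tube A R (U c). 1 / A \<le> norm (\<eta> c \<tau> x)) \<and>
           (\<forall>N z. norm (\<eta> c \<tau> (\<tau> + frame (U c) (R powr (1 / 2) / A) (R / A) z)) \<le> D N / (1 + norm z) ^ N) \<and>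
           (\<forall>z. norm z > A \<longrightarrow>
              (LINT x|lborel. \<eta> c \<tau> x *
                 cis (- 2 * pi * (x \<bullet> frame (U c) (A * R powr (- 1 / 2)) (A / R) z))) = 0)))"

text \<open>For \<open>v = extension f\<close>: the wave packet \<open>v\<^sub>\<theta>\<^sub>,\<^sub>T\<close>, where \<open>T = \<tau> + T\<^sub>\<theta>\<close>, and \<open>v\<^sub>\<theta> = \<Sum>\<^sub>T v\<^sub>\<theta>\<^sub>,\<^sub>T\<close>.\<close>

definition wave_packet ::
  "('n::finite pt \<Rightarrow> real) \<Rightarrow> real \<Rightarrow> (real ^ 'n \<Rightarrow> 'n pt \<Rightarrow> 'n pt \<Rightarrow> complex) \<Rightarrow> real ^ 'n \<Rightarrow> 'n pt \<Rightarrow> 'n pt \<Rightarrow> complex" where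
  "wave_packet f R \<eta> c \<tau> x = \<eta> c \<tau> x * extension (\<lambda>\<xi>. indicator (cap R c) \<xi> * f \<xi>) x"

definition cap_part ::
  "('n::finite pt \<Rightarrow> real) \<Rightarrow> real \<Rightarrow> (real ^ 'n \<Rightarrow> 'n pt set) \<Rightarrow> (real ^ 'n \<Rightarrow> 'n pt \<Rightarrow> 'n pt \<Rightarrow> complex) \<Rightarrow>
   real ^ 'n \<Rightarrow> 'n pt \<Rightarrow> complex" where
  "cap_part f R V \<eta> c x = (\<Sum>\<^sub>\<infinity>\<tau>\<in>V c. wave_packet f R \<eta> c \<tau> x)"

text \<open>
  The (nonzero) wave packets of \<open>extension f\<close> whose essential support, the tube \<open>T\<close>, is hit by \<open>x\<close>.
\<close>

definition packets_hit ::
  "('n::finite pt \<Rightarrow> real) \<Rightarrow> real \<Rightarrow> real \<Rightarrow> (real ^ 'n) set \<Rightarrow> (real ^ 'n \<Rightarrow> 'n pt \<Rightarrow> 'n pt) \<Rightarrow>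
   (real ^ 'n \<Rightarrow> 'n pt set) \<Rightarrow> (real ^ 'n \<Rightarrow> 'n pt \<Rightarrow> 'n pt \<Rightarrow> complex) \<Rightarrow> 'n pt \<Rightarrow> ((real ^ 'n) \<times> 'n pt) set" where
  "packets_hit f A R \<Theta> U V \<eta> x =
     {(c, \<tau>). c \<in> \<Theta> \<and> \<tau> \<in> V c \<and> wave_packet f R \<eta> c \<tau> \<noteq> (\<lambda>_. 0) \<and> x \<in> (+) \<tau> ` tube A R (U c)}"

definition hits_at_most :: "('a \<Rightarrow> 'b set) \<Rightarrow> 'a set \<Rightarrow> nat \<Rightarrow> bool" where
  "hits_at_most H X m \<longleftrightarrow> (\<forall>x\<in>X. finite (H x) \<and> card (H x) \<le> m)"

text \<open>A weight that behaves like the indicator of \<open>B\<^sub>R\<close> and has a rapidly decaying tail.\<close>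

definition ball_weight :: "real \<Rightarrow> (nat \<Rightarrow> real) \<Rightarrow> real \<Rightarrow> ('n::finite pt \<Rightarrow> real) \<Rightarrow> bool" where
  "ball_weight A D R w \<longleftrightarrow>
     w \<in> borel_measurable borel \<and> (\<forall>x. 0 \<le> w x) \<and> (\<forall>x \<in> ball 0 R. 1 / A \<le> w x) \<and>
     (\<forall>N x. w x \<le> D N / (1 + norm x / R) ^ N)"

definition decoupling_rhs ::
  "real \<Rightarrow> real \<Rightarrow> real \<Rightarrow> nat \<Rightarrow> (real ^ 'n::finite) set \<Rightarrow> ('n pt \<Rightarrow> real) \<Rightarrow> (real ^ 'n \<Rightarrow> 'n pt \<Rightarrow> complex) \<Rightarrow> real" where
  "decoupling_rhs \<epsilon> p R M \<Theta> w vcap =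
     R powr \<epsilon> * real M powr (1 / 2 - 1 / p) *
     (\<Sum>c\<in>\<Theta>. Lp_norm p (density lborel (\<lambda>x. ennreal (w x))) (vcap c) powr p) powr (1 / p)"

end

(*
  Trivially |g| <= int h. At a lattice point y in a small multiple of B_R, the phase y . xi on the
  1/R-box of h around xi_l stays close to the integer y . xi_l, so |g| >= (int h)/2 near y. These y
  are a fixed proportion of the lattice points of B_R, which gives the L^p norm on X.

  A cap meets O(1) boxes and a box meets O(1) caps, so ~ R^((d-1) sigma) caps carry g. Each x hits
  exactly one tube per cap, and at x = 0 all phases vanish, so the packets of the caps with a fixed
  proportion of the mass of a box are nonzero; this determines M. Since h restricted to a cap has
  support of diameter O(1/R), |g_theta| ~ R^-(d-1) on a small multiple of B_R for those caps, while
  |g_theta| = O(R^-(d-1)) for all caps and w has total mass ~ R^d. This gives the right hand side.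
*)

theory Submission
  imports Defs
begin


section \<open>Frequencies and the surface measure\<close>

text \<open>Throughout, n denotes \<open>CARD('n)\<close> = d - 1. The constants have to serve every
  R > 1, not only large R, and this shapes several arguments. For bounded R the spacing
  R^(-\<sigma>) of the frequencies and the side R^(-1/2) of the caps are comparable, so one cap can
  meet the boxes of several frequencies; such R are not excluded, their effect is absorbed into a
  constant depending on \<sigma> alone (\<open>merge_scale\<close>). Likewise a small multiple of
  B_R may contain no lattice point besides the origin, so the counts from below must stay valid in
  that case. A second obstacle is that a box may straddle several caps, and a cap that meets a box
  may carry almost none of its mass. Upper bounds therefore run over all caps that meet some box
  (\<open>active_caps\<close>), lower bounds over those with a guaranteed share
  (\<open>heavy_caps\<close>); pigeonholing shows that both families have size comparable to R^(n
  \<sigma>).\<close>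

lemma bij_betw_vec_nth_PiE:
  "bij_betw vec_nth {v :: 'a ^ 'n::finite. \<forall>j. v $ j \<in> S j} (PiE UNIV S)"
  by (rule bij_betw_byWitness[where f' = vec_lambda]) (auto simp: PiE_def)

lemma card_vec_components:
  "card {v :: 'a ^ 'n::finite. \<forall>j. v $ j \<in> S j} = (\<Prod>j\<in>UNIV. card (S j))"
  using bij_betw_same_card[OF bij_betw_vec_nth_PiE[of S]] by (simp add: card_PiE)

lemma finite_vec_components:
  assumes "\<And>j. finite (S j)"
  shows "finite {v :: 'a ^ 'n::finite. \<forall>j. v $ j \<in> S j}"
  using bij_betw_finite[OF bij_betw_vec_nth_PiE[of S]] assms by (simp add: finite_PiE)

definition freqs :: "real \<Rightarrow> real \<Rightarrow> (int ^ 'n::finite) set" where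
  "freqs \<sigma> R = {l. \<forall>j. 1 \<le> l $ j \<and> real_of_int (l $ j) < R powr \<sigma>}"

definition freq_box :: "real \<Rightarrow> real \<Rightarrow> int ^ 'n::finite \<Rightarrow> (real ^ 'n) set" where
  "freq_box \<sigma> R l =
     box (\<chi> j. real_of_int (l $ j) * R powr (- \<sigma>) - 1 / R)
         (\<chi> j. real_of_int (l $ j) * R powr (- \<sigma>) + 1 / R)"

lemma h_fun_eq: "h_fun \<sigma> R \<xi> = (\<Sum>l\<in>freqs \<sigma> R. indicator (freq_box \<sigma> R l) (fst \<xi>))"
  by (simp add: h_fun_def freqs_def freq_box_def)

lemma mem_freq_box_iff:
  "\<xi> \<in> freq_box \<sigma> R l \<longleftrightarrow> (\<forall>j. \<bar>\<xi> $ j - real_of_int (l $ j) * R powr (- \<sigma>)\<bar> < 1 / R)"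
  unfolding freq_box_def mem_box_cart abs_less_iff by (auto simp: algebra_simps)

lemma freqs_components:
  "freqs \<sigma> R = {l :: int ^ 'n::finite. \<forall>j. l $ j \<in> {1..<\<lceil>R powr \<sigma>\<rceil>}}"
  by (auto simp: freqs_def less_ceiling_iff)

lemma finite_freqs [simp]: "finite (freqs \<sigma> R)"
  unfolding freqs_components by (rule finite_vec_components) simp

text \<open>With t = R^\<sigma> > 1 each coordinate takes m = \<lceil>t\<rceil> - 1 values, and m
  \<ge> 1 gives m \<le> t \<le> m + 1 \<le> 2 m. Hence one factor 2 per coordinate, also for R near
  1, where (1, ..., 1) is the only frequency.\<close>

lemma freqs_card_bounds:
  assumes "R > 1" "\<sigma> > 0"
  shows "real (card (freqs \<sigma> R :: (int ^ 'n::finite) set)) \<le> R powr (real CARD('n) * \<sigma>)"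
    and "R powr (real CARD('n) * \<sigma>) \<le> 2 ^ CARD('n) * real (card (freqs \<sigma> R :: (int ^ 'n) set))"
proof -
  define t where "t = R powr \<sigma>"
  have t: "t > 1" using assms by (simp add: t_def)
  have c: "real (card (freqs \<sigma> R :: (int ^ 'n) set)) = (real_of_int (\<lceil>t\<rceil> - 1)) ^ CARD('n)"
    using t unfolding freqs_components card_vec_components t_def[symmetric] by simp
  have p: "R powr (real CARD('n) * \<sigma>) = t ^ CARD('n)"
    using assms by (simp add: t_def powr_powr powr_realpow[symmetric] mult.commute)
  define m where "m = \<lceil>t\<rceil> - 1"
  have "real_of_int m \<le> t" "t \<le> real_of_int m + 1" "m \<ge> 1"
    unfolding m_def using t by linarith+
  then have 1: "real_of_int m \<le> t" "t \<le> 2 * real_of_int m" "real_of_int m \<ge> 0"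
    by linarith+
  show "real (card (freqs \<sigma> R :: (int ^ 'n) set)) \<le> R powr (real CARD('n) * \<sigma>)"
    unfolding c p m_def[symmetric] by (rule power_mono) (use 1 in auto)
  show "R powr (real CARD('n) * \<sigma>) \<le> 2 ^ CARD('n) * real (card (freqs \<sigma> R :: (int ^ 'n) set))"
    unfolding c p m_def[symmetric] power_mult_distrib[symmetric] by (rule power_mono) (use 1 t in auto)
qed

section \<open>The surface measure seen through its projection\<close>

definition unit_cube :: "(real ^ 'n::finite) set" where
  "unit_cube = {\<xi>. \<forall>j. \<bar>\<xi> $ j\<bar> \<le> 1}"

lemma unit_cube_eq_cbox: "unit_cube = cbox (-1) (1 :: real ^ 'n::finite)"
  by (auto simp: unit_cube_def mem_box_cart abs_le_iff)

lemma norm_le_CARD: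
  fixes x :: "real ^ 'n::finite"
  assumes "\<And>j. \<bar>x $ j\<bar> \<le> r"
  shows "norm x \<le> real CARD('n) * r"
  using norm_le_l1_cart[of x] sum_bounded_above[of UNIV "\<lambda>j. \<bar>x $ j\<bar>" r] assms by force

lemma unit_cube_borel [measurable]: "unit_cube \<in> sets borel"
  by (simp add: unit_cube_eq_cbox)

definition surface_density :: "real ^ 'n::finite \<Rightarrow> real" where
  "surface_density \<xi> = indicator unit_cube \<xi> * sqrt (1 + (norm (2 *\<^sub>R \<xi>))\<^sup>2)"

lemma surface_measure_eq:
  "surface_measure = distr (density lborel (\<lambda>\<xi> :: real ^ 'n::finite. ennreal (surface_density \<xi>)))
     borel (\<lambda>\<xi>. (\<xi>, (norm \<xi>)\<^sup>2))"
  by (simp add: surface_measure_def surface_density_def unit_cube_def)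

lemma surface_density_measurable [measurable]: "surface_density \<in> borel_measurable borel"
  unfolding surface_density_def by measurable

lemma lift_measurable [measurable]: "(\<lambda>\<xi> :: real ^ 'n::finite. (\<xi>, (norm \<xi>)\<^sup>2)) \<in> borel_measurable borel"
  by (intro borel_measurable_continuous_onI continuous_intros)

text \<open>The gradient 2 \<xi>' has norm at most 2 n on the cube. So surface measure and Lebesgue
  measure of the projection agree up to the factor 1 + 2 n, and volumes can be estimated in the
  first d - 1 coordinates.\<close>

lemma surface_density_bounds:
  "indicator unit_cube \<xi> \<le> surface_density \<xi>"
  "surface_density (\<xi> :: real ^ 'n::finite) \<le> (1 + 2 * real CARD('n)) * indicator unit_cube \<xi>"
proof -
  show "indicator unit_cube \<xi> \<le> surface_density \<xi>"
    by (auto simp: surface_density_def indicator_def)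
  have "sqrt (1 + (norm (2 *\<^sub>R \<xi>))\<^sup>2) \<le> 1 + 2 * real CARD('n)" if "\<xi> \<in> unit_cube"
  proof -
    have "norm \<xi> \<le> real CARD('n)"
      using norm_le_CARD[of \<xi> 1] that by (simp add: unit_cube_def)
    moreover have "sqrt (1 + (norm (2 *\<^sub>R \<xi>))\<^sup>2) \<le> sqrt 1 + sqrt ((norm (2 *\<^sub>R \<xi>))\<^sup>2)"
      by (rule sqrt_add_le_add_sqrt) auto
    ultimately show ?thesis by (simp add: real_sqrt_mult)
  qed
  then show "surface_density \<xi> \<le> (1 + 2 * real CARD('n)) * indicator unit_cube \<xi>"
    by (auto simp: surface_density_def indicator_def)
qed

lemma sets_surface_measure [simp, measurable_cong]: "sets surface_measure = sets borel"
  by (simp add: surface_measure_eq)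

lemma space_surface_measure [simp]: "space surface_measure = UNIV"
  by (simp add: surface_measure_eq)

lemma fst_borel_measurable:
  "(fst :: 'a::topological_space \<times> 'b::topological_space \<Rightarrow> 'a) \<in> borel_measurable borel"
  by (intro borel_measurable_continuous_onI continuous_intros)

lemma fst_preimage_borel: "B \<in> sets borel \<Longrightarrow> {\<xi>. fst \<xi> \<in> B} \<in> sets borel"
  using measurable_sets[OF fst_borel_measurable] by (simp add: vimage_def)

lemma emeasure_surface_measure_fst:
  assumes [measurable]: "B \<in> sets borel"
  shows "emeasure surface_measure {\<xi> :: 'n::finite pt. fst \<xi> \<in> B} =
    (\<integral>\<^sup>+\<xi>. ennreal (surface_density \<xi>) * indicator B \<xi> \<partial>lborel)"
proof -
  have [measurable]: "{\<xi> :: 'n pt. fst \<xi> \<in> B} \<in> sets borel"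
    using assms by (rule fst_preimage_borel)
  show ?thesis
    unfolding surface_measure_eq
    by (subst emeasure_distr) (auto simp: emeasure_density vimage_def)
qed

lemma surface_measure_fst_bounds:
  fixes B :: "(real ^ 'n::finite) set"
  assumes [measurable]: "B \<in> sets borel"
  shows "emeasure lborel (B \<inter> unit_cube) \<le> emeasure surface_measure {\<xi>. fst \<xi> \<in> B}"
    and "emeasure surface_measure {\<xi>. fst \<xi> \<in> B} \<le> ennreal (1 + 2 * real CARD('n)) * emeasure lborel (B \<inter> unit_cube)"
proof -
  have "emeasure lborel (B \<inter> unit_cube) = (\<integral>\<^sup>+\<xi>. indicator (B \<inter> unit_cube) \<xi> \<partial>lborel)"
    by simp
  also have "\<dots> \<le> (\<integral>\<^sup>+\<xi>. ennreal (surface_density \<xi>) * indicator B \<xi> \<partial>lborel)"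
  proof (intro nn_integral_mono)
    fix \<xi> :: "real ^ 'n"
    show "indicator (B \<inter> unit_cube) \<xi> \<le> ennreal (surface_density \<xi>) * indicator B \<xi>"
      using surface_density_bounds(1)[of \<xi>] by (auto simp: indicator_def split: if_splits)
  qed
  finally show "emeasure lborel (B \<inter> unit_cube) \<le> emeasure surface_measure {\<xi>. fst \<xi> \<in> B}"
    by (simp add: emeasure_surface_measure_fst)
  have "(\<integral>\<^sup>+\<xi>. ennreal (surface_density \<xi>) * indicator B \<xi> \<partial>lborel)
      \<le> (\<integral>\<^sup>+\<xi>. ennreal (1 + 2 * real CARD('n)) * indicator (B \<inter> unit_cube) \<xi> \<partial>lborel)"
  proof (intro nn_integral_mono)
    fix \<xi> :: "real ^ 'n"
    show "ennreal (surface_density \<xi>) * indicator B \<xi> \<le> ennreal (1 + 2 * real CARD('n)) * indicator (B \<inter> unit_cube) \<xi>"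
      using surface_density_bounds(2)[of \<xi>] by (auto simp: indicator_def ennreal_neg split: if_splits intro!: ennreal_leI simp del: ennreal_plus)
  qed
  then show "emeasure surface_measure {\<xi>. fst \<xi> \<in> B} \<le> ennreal (1 + 2 * real CARD('n)) * emeasure lborel (B \<inter> unit_cube)"
    by (simp add: emeasure_surface_measure_fst nn_integral_cmult)
qed

lemma unit_cube_fmeasurable: "unit_cube \<in> fmeasurable (lborel :: (real ^ 'n::finite) measure)"
  by (simp add: unit_cube_eq_cbox)

lemma finite_surface_measure: "finite_measure (surface_measure :: 'n::finite pt measure)"
proof
  have "emeasure surface_measure {\<xi> :: 'n pt. fst \<xi> \<in> UNIV} < \<infinity>"
    using unit_cube_fmeasurable
    by (intro le_less_trans[OF surface_measure_fst_bounds(2)])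
      (auto simp: ennreal_mult_less_top fmeasurable_def)
  then show "emeasure (surface_measure :: 'n pt measure) (space surface_measure) \<noteq> \<infinity>" by simp
qed

lemma closed_paraboloid: "closed (paraboloid :: 'n::finite pt set)"
  unfolding paraboloid_def
  by (intro closed_Collect_conj closed_Collect_eq closed_Collect_all closed_Collect_le continuous_intros)

lemma paraboloid_borel [measurable]: "paraboloid \<in> sets borel"
  by (simp add: closed_paraboloid)

text \<open>The density vanishes off \<open>unit_cube\<close>, and the lift maps
  \<open>unit_cube\<close> into the paraboloid. Phase estimates are thus needed only at points that
  are determined by their projection.\<close>

lemma AE_surface_measure_paraboloid: "AE \<xi> in surface_measure. \<xi> \<in> (paraboloid :: 'n::finite pt set)"
  unfolding surface_measure_eq
  by (subst AE_distr_iff)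
    (use paraboloid_borel in \<open>auto simp: AE_density, auto simp: paraboloid_def surface_density_def indicator_def unit_cube_def\<close>)

section \<open>Bounds for the extension operator\<close>

lemma integrable_surface_measure_bounded:
  fixes f :: "'n::finite pt \<Rightarrow> real"
  assumes [measurable]: "f \<in> borel_measurable borel" and "\<And>\<xi>. \<bar>f \<xi>\<bar> \<le> B"
  shows "integrable surface_measure f"
proof -
  interpret finite_measure "surface_measure :: 'n pt measure" by (rule finite_surface_measure)
  show ?thesis
    by (rule integrable_const_bound[where B = B]) (use assms(2) in auto)
qed

lemma cis_measurable [measurable]: "cis \<in> borel_measurable borel"
  by (intro borel_measurable_continuous_onI continuous_intros)

lemma norm_extension_le:
  assumes "\<And>\<xi>. 0 \<le> f \<xi>"
  shows "norm (extension f x) \<le> (LINT \<xi>|surface_measure. f \<xi>)"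
proof -
  have "norm (extension f x) \<le> (LINT \<xi>|surface_measure. norm (cis (2 * pi * (x \<bullet> \<xi>)) * complex_of_real (f \<xi>)))"
    unfolding extension_def by (rule integral_norm_bound)
  also have "\<dots> = (LINT \<xi>|surface_measure. f \<xi>)"
    using assms by (simp add: norm_mult)
  finally show ?thesis .
qed

lemma cos_ge_half_near_Ints:
  assumes "k \<in> \<int>" "\<bar>s - k\<bar> \<le> 1 / 8"
  shows "cos (2 * pi * s) \<ge> 1 / 2"
proof -
  obtain m where m: "k = real_of_int m" using assms(1) by (auto elim: Ints_cases)
  have "cos (2 * pi * s) = cos (2 * pi * (s - k) + of_int m * (2 * pi))"
    by (simp add: m algebra_simps)
  also have "\<dots> = cos (2 * pi * (s - k))"
    by (simp only: cos_add mult.commute[of "of_int m"] cos_int_2pin sin_int_2pin mult_zero_right diff_zero mult_1_right)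
  also have "\<dots> = cos \<bar>2 * pi * (s - k)\<bar>" by simp
  \<comment> \<open>The angle is at most 2 pi / 8 = pi / 4, which is below pi / 3.\<close>
  also have "\<dots> \<ge> cos (pi / 3)"
    using assms(2) by (intro cos_monotone_0_pi_le) (auto simp: abs_mult)
  finally show ?thesis by (simp add: cos_60)
qed

text \<open>Absence of cancellation: after rotation by \<open>cis (- 2 * pi * t)\<close> the
  integrand has real part at least f / 2 almost everywhere. The shift t is free: near lattice points
  t = 0 and k is an arbitrary integer, for a single cap k = 0 and t is the phase of a reference
  point.\<close>

lemma norm_extension_ge:
  fixes f :: "'n::finite pt \<Rightarrow> real"
  assumes f: "integrable surface_measure f" and nonneg: "\<And>\<xi>. 0 \<le> f \<xi>"
    and phase: "\<And>\<xi>. \<xi> \<in> paraboloid \<Longrightarrow> f \<xi> \<noteq> 0 \<Longrightarrow> \<exists>k\<in>\<int>. \<bar>x \<bullet> \<xi> - t - k\<bar> \<le> 1 / 8"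
  shows "(LINT \<xi>|surface_measure. f \<xi>) / 2 \<le> norm (extension f x)"
proof -
  let ?F = "\<lambda>\<xi>. cis (2 * pi * (x \<bullet> \<xi>)) * complex_of_real (f \<xi>)"
  have [measurable]: "f \<in> borel_measurable borel"
    using borel_measurable_integrable[OF f] by simp
  have F: "integrable surface_measure ?F"
    by (rule Bochner_Integration.integrable_bound[OF f]) (auto simp: norm_mult)
  have G: "integrable surface_measure (\<lambda>\<xi>. cis (- 2 * pi * t) * ?F \<xi>)"
    using F by simp
  have eq: "Re (cis (- 2 * pi * t) * ?F \<xi>) = cos (2 * pi * (x \<bullet> \<xi> - t)) * f \<xi>" for \<xi>
  proof -
    have "cis (- 2 * pi * t) * ?F \<xi> = cis (2 * pi * (x \<bullet> \<xi> - t)) * complex_of_real (f \<xi>)"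
      by (simp only: mult.assoc[symmetric] cis_mult) (simp add: right_diff_distrib)
    then show ?thesis by (simp only:) simp
  qed
  have "(LINT \<xi>|surface_measure. f \<xi>) / 2 = (LINT \<xi>|surface_measure. f \<xi> / 2)" by simp
  also have "\<dots> \<le> (LINT \<xi>|surface_measure. Re (cis (- 2 * pi * t) * ?F \<xi>))"
  proof (rule integral_mono_AE)
    show "integrable surface_measure (\<lambda>\<xi>. f \<xi> / 2)" using f by simp
    show "integrable surface_measure (\<lambda>\<xi>. Re (cis (- 2 * pi * t) * ?F \<xi>))"
      using G by (rule integrable_Re)
    show "AE \<xi> in surface_measure. f \<xi> / 2 \<le> Re (cis (- 2 * pi * t) * ?F \<xi>)"
      using AE_surface_measure_paraboloid
    proof eventually_elim
      case (elim \<xi>)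
      show ?case
      proof (cases "f \<xi> = 0")
        case False
        with phase[OF elim] obtain k where "k \<in> \<int>" "\<bar>x \<bullet> \<xi> - t - k\<bar> \<le> 1 / 8" by blast
        from cos_ge_half_near_Ints[OF this] have "1 / 2 * f \<xi> \<le> cos (2 * pi * (x \<bullet> \<xi> - t)) * f \<xi>"
          using nonneg by (rule mult_right_mono)
        then show ?thesis unfolding eq by simp
      qed simp
    qed
  qed
  also have "\<dots> = Re (cis (- 2 * pi * t) * extension f x)"
    unfolding extension_def by (simp only: integral_Re[OF G] integral_mult_right_zero)
  also have "\<dots> \<le> norm (cis (- 2 * pi * t) * extension f x)" by (rule complex_Re_le_cmod)
  finally show ?thesis by (simp add: norm_mult)
qed

lemma extension_measurable:
  fixes f :: "'n::finite pt \<Rightarrow> real"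
  assumes [measurable]: "f \<in> borel_measurable borel"
  shows "extension f \<in> borel_measurable borel"
proof -
  interpret finite_measure "surface_measure :: 'n pt measure" by (rule finite_surface_measure)
  show ?thesis unfolding extension_def by measurable
qed

lemma freq_box_measurable [measurable]: "freq_box \<sigma> R l \<in> sets borel"
  by (simp add: freq_box_def)

lemma fst_indicator_measurable [measurable]:
  "B \<in> sets borel \<Longrightarrow> (\<lambda>\<xi> :: 'n::finite pt. indicator B (fst \<xi>) :: real) \<in> borel_measurable borel"
  by (rule measurable_compose[OF fst_borel_measurable borel_measurable_indicator])

lemma h_fun_measurable [measurable]: "h_fun \<sigma> R \<in> borel_measurable borel"
  unfolding h_fun_eq[abs_def] by measurable

lemma h_fun_nonneg: "0 \<le> h_fun \<sigma> R \<xi>"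
  unfolding h_fun_eq by (intro sum_nonneg) auto

text \<open>For arbitrary \<sigma> and R the boxes may overlap, so values above 1 are not ruled out
  here. The crude bound serves integrability.\<close>

lemma h_fun_le_card: "h_fun \<sigma> R (\<xi> :: 'n::finite pt) \<le> real (card (freqs \<sigma> R :: (int ^ 'n) set))"
  unfolding h_fun_eq using sum_bounded_above[of "freqs \<sigma> R" "\<lambda>l. indicat_real (freq_box \<sigma> R l) (fst \<xi>)" 1]
  by (simp add: indicator_le_1)

lemma h_fun_ne_zeroE:
  assumes "h_fun \<sigma> R \<xi> \<noteq> 0"
  obtains l where "l \<in> freqs \<sigma> R" "fst \<xi> \<in> freq_box \<sigma> R l"
  using sum.not_neutral_contains_not_neutral[OF assms[unfolded h_fun_eq]]
  by (auto simp: indicator_def split: if_splits)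

section \<open>Volumes and masses of the frequency boxes\<close>

lemma emeasure_lborel_box_cart:
  fixes a b :: "real ^ 'n::finite"
  assumes "\<And>j. a $ j \<le> b $ j"
  shows "emeasure lborel (box a b) = ennreal (\<Prod>j\<in>UNIV. b $ j - a $ j)"
    "measure lborel (box a b) = (\<Prod>j\<in>UNIV. b $ j - a $ j)"
proof -
  have ne: "cbox a b \<noteq> {}" using assms by (auto simp: interval_ne_empty_cart)
  have "measure lborel (box a b) = measure lborel (cbox a b)"
    by (simp add: measure_lborel_box_eq measure_lborel_cbox_eq)
  then show m: "measure lborel (box a b) = (\<Prod>j\<in>UNIV. b $ j - a $ j)"
    using content_cbox_cart[OF ne] by simp
  show "emeasure lborel (box a b) = ennreal (\<Prod>j\<in>UNIV. b $ j - a $ j)"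
    using m emeasure_eq_measure2[of "box a b" lborel] by simp
qed

lemma emeasure_freq_box:
  assumes "R > 0"
  shows "emeasure lborel (freq_box \<sigma> R (l :: int ^ 'n::finite)) = ennreal ((2 / R) ^ CARD('n))"
  unfolding freq_box_def using assms
  by (subst emeasure_lborel_box_cart) auto

text \<open>A box may stick out of the unit cube beyond coordinate 1. Its centre has coordinates in
  (0, 1) and 1 / R < 1, so the subcube of side 1 / R below the centre stays inside.\<close>

lemma emeasure_freq_box_unit_cube_ge:
  fixes l :: "int ^ 'n::finite"
  assumes "R > 1" "l \<in> freqs \<sigma> R"
  shows "ennreal ((1 / R) ^ CARD('n)) \<le> emeasure lborel (freq_box \<sigma> R l \<inter> unit_cube)"
proof -
  let ?c = "\<lambda>j. real_of_int (l $ j) * R powr (- \<sigma>)"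
  have c: "0 < ?c j" "?c j < 1" for j
  proof -
    have "1 \<le> l $ j" using assms by (simp add: freqs_def)
    then show "0 < ?c j" using assms by simp
    have "real_of_int (l $ j) * R powr (- \<sigma>) < R powr \<sigma> * R powr (- \<sigma>)"
      using assms by (intro mult_strict_right_mono) (auto simp: freqs_def)
    then show "?c j < 1" using assms by (simp add: powr_add[symmetric])
  qed
  have R: "1 / R < 1" "1 / R > 0" using assms by auto
  have "ennreal ((1 / R) ^ CARD('n)) = emeasure lborel (box (\<chi> j. ?c j - 1 / R) (\<chi> j. ?c j))"
    using assms by (subst emeasure_lborel_box_cart) auto
  also have "\<dots> \<le> emeasure lborel (freq_box \<sigma> R l \<inter> unit_cube)"
  proof (rule emeasure_mono)
    show "box (\<chi> j. ?c j - 1 / R) (\<chi> j. ?c j) \<subseteq> freq_box \<sigma> R l \<inter> unit_cube"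
    proof
      fix x :: "real ^ 'n" assume x: "x \<in> box (\<chi> j. ?c j - 1 / R) (\<chi> j. ?c j)"
      have "\<bar>x $ j - ?c j\<bar> < 1 / R \<and> \<bar>x $ j\<bar> \<le> 1" for j
      proof -
        have "?c j - 1 / R < x $ j" "x $ j < ?c j" using x by (auto simp: mem_box_cart)
        then show ?thesis using c[of j] R by linarith
      qed
      then show "x \<in> freq_box \<sigma> R l \<inter> unit_cube" by (simp add: mem_freq_box_iff unit_cube_def)
    qed
  qed simp
  finally show ?thesis .
qed

lemma measure_surface_measure_fst_bounds:
  fixes B :: "(real ^ 'n::finite) set"
  assumes [measurable]: "B \<in> sets borel"
  shows "measure lborel (B \<inter> unit_cube) \<le> measure surface_measure {\<xi>. fst \<xi> \<in> B}"
    and "measure surface_measure {\<xi>. fst \<xi> \<in> B} \<le> (1 + 2 * real CARD('n)) * measure lborel (B \<inter> unit_cube)"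
proof -
  interpret finite_measure "surface_measure :: 'n pt measure" by (rule finite_surface_measure)
  have "B \<inter> unit_cube \<in> fmeasurable lborel"
    by (intro fmeasurableI2[OF unit_cube_fmeasurable]) auto
  then have *: "emeasure lborel (B \<inter> unit_cube) = ennreal (measure lborel (B \<inter> unit_cube))"
    by (simp add: emeasure_eq_measure2)
  show "measure lborel (B \<inter> unit_cube) \<le> measure surface_measure {\<xi>. fst \<xi> \<in> B}"
    using surface_measure_fst_bounds(1)[OF assms] unfolding * emeasure_eq_measure by simp
  show "measure surface_measure {\<xi>. fst \<xi> \<in> B} \<le> (1 + 2 * real CARD('n)) * measure lborel (B \<inter> unit_cube)"
    using surface_measure_fst_bounds(2)[OF assms] unfolding * emeasure_eq_measure
    by (subst (asm) ennreal_mult[symmetric]) (auto simp del: ennreal_plus)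
qed

lemma measure_freq_box_bounds:
  fixes l :: "int ^ 'n::finite"
  assumes "R > 1"
  shows "measure surface_measure {\<xi>. fst \<xi> \<in> freq_box \<sigma> R l} \<le> (1 + 2 * real CARD('n)) * (2 / R) ^ CARD('n)"
    and "l \<in> freqs \<sigma> R \<Longrightarrow> (1 / R) ^ CARD('n) \<le> measure lborel (freq_box \<sigma> R l \<inter> unit_cube)"
proof -
  have f: "freq_box \<sigma> R l \<in> fmeasurable lborel"
    unfolding freq_box_def by simp
  have e: "measure lborel (freq_box \<sigma> R l) = (2 / R) ^ CARD('n)"
    using assms by (simp add: measure_def emeasure_freq_box)
  have "measure lborel (freq_box \<sigma> R l \<inter> unit_cube) \<le> (2 / R) ^ CARD('n)"
    unfolding e[symmetric, of ] using f by (intro measure_mono_fmeasurable) auto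
  then show "measure surface_measure {\<xi>. fst \<xi> \<in> freq_box \<sigma> R l} \<le> (1 + 2 * real CARD('n)) * (2 / R) ^ CARD('n)"
    by (intro order_trans[OF measure_surface_measure_fst_bounds(2)] mult_left_mono) auto
  assume "l \<in> freqs \<sigma> R"
  from emeasure_freq_box_unit_cube_ge[OF assms this]
  show "(1 / R) ^ CARD('n) \<le> measure lborel (freq_box \<sigma> R l \<inter> unit_cube)"
    using f assms by (subst (asm) emeasure_eq_measure2) (auto intro: fmeasurable_Int_fmeasurable)
qed

lemma integral_surface_measure_freq_indicators:
  fixes L :: "(int ^ 'n::finite) set"
  assumes "finite L"
  shows "integrable surface_measure (\<lambda>\<xi>. \<Sum>l\<in>L. indicat_real (freq_box \<sigma> R l) (fst \<xi>))"
    and "(LINT \<xi>|surface_measure. (\<Sum>l\<in>L. indicat_real (freq_box \<sigma> R l) (fst \<xi>))) =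
      (\<Sum>l\<in>L. measure surface_measure {\<xi>. fst \<xi> \<in> freq_box \<sigma> R l})"
proof -
  have int: "integrable surface_measure (\<lambda>\<xi> :: 'n pt. indicator (freq_box \<sigma> R l) (fst \<xi>) :: real)" for l
    by (rule integrable_surface_measure_bounded[where B = 1])
      (use fst_indicator_measurable[OF freq_box_measurable] in \<open>simp_all add: indicator_le_1\<close>)
  then show "integrable surface_measure (\<lambda>\<xi>. \<Sum>l\<in>L. indicat_real (freq_box \<sigma> R l) (fst \<xi>))"
    by simp
  have "(\<lambda>\<xi> :: 'n pt. indicator (freq_box \<sigma> R l) (fst \<xi>) :: real) = indicator {\<xi>. fst \<xi> \<in> freq_box \<sigma> R l}" for l
    by (auto simp: indicator_def)
  then have "(LINT \<xi>|surface_measure. indicat_real (freq_box \<sigma> R l) (fst \<xi>)) =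
      measure surface_measure {\<xi> :: 'n pt. fst \<xi> \<in> freq_box \<sigma> R l}" for l
    by simp
  then show "(LINT \<xi>|surface_measure. (\<Sum>l\<in>L. indicat_real (freq_box \<sigma> R l) (fst \<xi>))) =
      (\<Sum>l\<in>L. measure surface_measure {\<xi>. fst \<xi> \<in> freq_box \<sigma> R l})"
    using int by (subst Bochner_Integration.integral_sum) auto
qed

section \<open>The lattice and its neighbourhood\<close>

text \<open>Applied to two finite measures: Lebesgue measure on X, and the weighted measure of the
  decoupling inequality. Finiteness makes the bounded integrand integrable, without which the lower
  bound would fail.\<close>

lemma (in finite_measure) integral_norm_powr_bounds:
  fixes f :: "'a \<Rightarrow> complex"
  assumes [measurable]: "f \<in> borel_measurable M" and p: "p > 0"
    and bound: "\<And>x. x \<in> space M \<Longrightarrow> norm (f x) \<le> b"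
  shows "(LINT x|M. norm (f x) powr p) \<le> b powr p * measure M (space M)"
    and "Y \<in> sets M \<Longrightarrow> 0 \<le> a \<Longrightarrow> (\<And>x. x \<in> Y \<Longrightarrow> a \<le> norm (f x)) \<Longrightarrow>
      a powr p * measure M Y \<le> (LINT x|M. norm (f x) powr p)"
proof -
  have le: "norm (f x) powr p \<le> b powr p" if "x \<in> space M" for x
    using bound[OF that] p by (intro powr_mono2) auto
  have int: "integrable M (\<lambda>x. norm (f x) powr p)"
    by (rule integrable_const_bound[where B = "b powr p"]) (use le in auto)
  have "(LINT x|M. norm (f x) powr p) \<le> (LINT x|M. b powr p)"
    by (rule integral_mono[OF int]) (use le in auto)
  then show "(LINT x|M. norm (f x) powr p) \<le> b powr p * measure M (space M)"
    by (simp add: mult.commute)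
  assume Y [measurable]: "Y \<in> sets M" and "0 \<le> a" and a: "\<And>x. x \<in> Y \<Longrightarrow> a \<le> norm (f x)"
  have "(LINT x|M. a powr p * indicator Y x) \<le> (LINT x|M. norm (f x) powr p)"
  proof (rule integral_mono[OF _ int])
    show "integrable M (\<lambda>x. a powr p * indicator Y x)"
      by (intro integrable_mult_right integrable_real_indicator) (auto simp: less_top[symmetric])
    show "a powr p * indicator Y x \<le> norm (f x) powr p" for x
      using a[of x] \<open>0 \<le> a\<close> p by (auto simp: indicator_def intro!: powr_mono2)
  qed
  then show "a powr p * measure M Y \<le> (LINT x|M. norm (f x) powr p)"
    using Y[THEN sets.sets_into_space] by (simp add: Int_absorb2)
qed

text \<open>The count is 2 \<lfloor>a\<rfloor> + 1. The integer 0 keeps the lower bound true for a <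
  1, that is, when a small ball contains few lattice points.\<close>

lemma card_int_abs_le:
  assumes "a \<ge> 0"
  shows "finite {m :: int. \<bar>real_of_int m\<bar> \<le> a}"
    and "real (card {m :: int. \<bar>real_of_int m\<bar> \<le> a}) \<le> 2 * a + 1"
    and "a \<le> real (card {m :: int. \<bar>real_of_int m\<bar> \<le> a})"
proof -
  have eq: "{m :: int. \<bar>real_of_int m\<bar> \<le> a} = {- \<lfloor>a\<rfloor>..\<lfloor>a\<rfloor>}"
    by (auto simp: abs_le_iff le_floor_iff) linarith+
  show "finite {m :: int. \<bar>real_of_int m\<bar> \<le> a}" unfolding eq by simp
  have "\<lfloor>a\<rfloor> \<ge> 0" using assms by simp
  then have "real (card {m :: int. \<bar>real_of_int m\<bar> \<le> a}) = 2 * real_of_int \<lfloor>a\<rfloor> + 1"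
    unfolding eq by simp
  then show "real (card {m :: int. \<bar>real_of_int m\<bar> \<le> a}) \<le> 2 * a + 1"
    and "a \<le> real (card {m :: int. \<bar>real_of_int m\<bar> \<le> a})"
    using assms real_of_int_floor_add_one_gt[of a] \<open>\<lfloor>a\<rfloor> \<ge> 0\<close> by linarith+
qed

section \<open>Counting lattice points in balls\<close>

definition lattice_pt :: "real \<Rightarrow> real \<Rightarrow> (int ^ 'n::finite) \<times> int \<Rightarrow> 'n pt" where
  "lattice_pt \<sigma> R mk = ((\<chi> j. real_of_int (fst mk $ j) * R powr \<sigma>), real_of_int (snd mk) * R powr (2 * \<sigma>))"

lemma lattice_eq_range: "lattice \<sigma> R = range (lattice_pt \<sigma> R)"
  by (auto simp: lattice_def lattice_pt_def image_def)

lemma abs_component_le_norm_pt: "\<bar>fst z $ j\<bar> \<le> norm (z :: 'n::finite pt)" "\<bar>snd z\<bar> \<le> norm (z :: 'n pt)"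
  using component_le_norm_cart[of "fst z" j] norm_fst_le[of "fst z" "snd z"] norm_snd_le[of "snd z" "fst z"] by auto

lemma norm_pt_le:
  fixes z :: "'n::finite pt"
  assumes "\<And>j. \<bar>fst z $ j\<bar> \<le> r" "\<bar>snd z\<bar> \<le> s"
  shows "norm z \<le> real CARD('n) * r + s"
  using norm_Pair_le[of "fst z" "snd z"] norm_le_CARD[of "fst z" r] assms by simp

text \<open>Both spacings R^\<sigma> and R^(2 \<sigma>) are at least 1, so one differing integer
  coordinate suffices. This makes small balls around lattice points disjoint.\<close>

lemma lattice_separated:
  fixes y :: "'n::finite pt"
  assumes "R \<ge> 1" "\<sigma> \<ge> 0" "y \<in> lattice \<sigma> R" "z \<in> lattice \<sigma> R" "y \<noteq> z"
  shows "1 \<le> norm (y - z)"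
proof -
  have ge: "R powr \<sigma> \<ge> 1" "R powr (2 * \<sigma>) \<ge> 1" using assms by (auto intro: ge_one_powr_ge_zero)
  have diff: "1 \<le> \<bar>real_of_int a * t - real_of_int b * t\<bar>" if "a \<noteq> b" "t \<ge> 1" for a b t
  proof -
    have "1 \<le> \<bar>real_of_int (a - b)\<bar>" using that by linarith
    then have "1 * 1 \<le> \<bar>real_of_int (a - b)\<bar> * t" using that by (intro mult_mono) auto
    also have "\<dots> = \<bar>real_of_int a * t - real_of_int b * t\<bar>"
      using that by (simp add: abs_mult left_diff_distrib[symmetric])
    finally show ?thesis by simp
  qed
  obtain a b where ab: "y = lattice_pt \<sigma> R a" "z = lattice_pt \<sigma> R b"
    using assms by (auto simp: lattice_eq_range)
  with assms(5) have "a \<noteq> b" by auto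
  then consider j where "fst a $ j \<noteq> fst b $ j" | "snd a \<noteq> snd b"
    by (auto simp: prod_eq_iff vec_eq_iff)
  then show ?thesis
  proof cases
    case 1
    with diff[OF _ ge(1)] have "1 \<le> \<bar>fst (y - z) $ j\<bar>" by (simp add: ab lattice_pt_def)
    also have "\<dots> \<le> norm (y - z)" by (rule abs_component_le_norm_pt)
    finally show ?thesis .
  next
    case 2
    with diff[OF _ ge(2)] have "1 \<le> \<bar>snd (y - z)\<bar>" by (simp add: ab lattice_pt_def)
    also have "\<dots> \<le> norm (y - z)" by (rule abs_component_le_norm_pt)
    finally show ?thesis .
  qed
qed

lemma inj_lattice_pt: "R > 0 \<Longrightarrow> inj (lattice_pt \<sigma> R)"
  by (auto simp: inj_def lattice_pt_def prod_eq_iff vec_eq_iff)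

lemma lattice_ball_upper:
  assumes "R > 1" "0 < \<sigma>" "\<sigma> < 1 / 2"
  shows "finite (lattice \<sigma> R \<inter> ball 0 R :: 'n::finite pt set)"
    and "real (card (lattice \<sigma> R \<inter> ball 0 R :: 'n pt set))
      \<le> 3 ^ (CARD('n) + 1) * R powr (real CARD('n) * (1 - \<sigma>) + (1 - 2 * \<sigma>))"
proof -
  let ?a = "R powr (1 - \<sigma>)" and ?b = "R powr (1 - 2 * \<sigma>)"
  let ?I = "\<lambda>a. {m :: int. \<bar>real_of_int m\<bar> \<le> a}"
  \<comment> \<open>Here \<sigma> < 1/2 enters: both half-lengths are at least 1, so the count 2 a +
    1 is at most 3 a in every direction.\<close>
  have ab: "?a \<ge> 1" "?b \<ge> 1" using assms by (auto intro: ge_one_powr_ge_zero)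
  let ?J = "{m :: int ^ 'n. \<forall>j. m $ j \<in> ?I ?a} \<times> ?I ?b"
  have fin: "finite ?J"
    using ab by (intro finite_cartesian_product finite_vec_components card_int_abs_le) auto
  have sub: "lattice \<sigma> R \<inter> ball 0 R \<subseteq> lattice_pt \<sigma> R ` ?J"
  proof
    fix y :: "'n pt" assume y: "y \<in> lattice \<sigma> R \<inter> ball 0 R"
    then obtain mk where mk: "y = lattice_pt \<sigma> R mk" by (auto simp: lattice_eq_range)
    have *: "\<bar>real_of_int k\<bar> \<le> R powr (1 - s)" if "\<bar>real_of_int k * R powr s\<bar> \<le> norm y" for k s
    proof -
      have "\<bar>real_of_int k\<bar> * R powr s \<le> R powr 1"
        using that y assms by (auto simp: abs_mult)
      then show ?thesis using assms by (simp add: powr_diff field_simps)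
    qed
    have "mk \<in> ?J"
      using *[of "fst mk $ _" \<sigma>] *[of "snd mk" "2 * \<sigma>"] abs_component_le_norm_pt[of y]
      by (auto simp: mk lattice_pt_def mem_Times_iff)
    then show "y \<in> lattice_pt \<sigma> R ` ?J" using mk by blast
  qed
  show "finite (lattice \<sigma> R \<inter> ball 0 R :: 'n pt set)"
    using finite_subset[OF sub] fin by blast
  have "card (lattice \<sigma> R \<inter> ball 0 R :: 'n pt set) \<le> card ?J"
    using card_mono[OF _ sub] card_image_le[OF fin, of "lattice_pt \<sigma> R"] fin by fastforce
  then have "real (card (lattice \<sigma> R \<inter> ball 0 R :: 'n pt set)) \<le> real (card (?I ?a)) ^ CARD('n) * real (card (?I ?b))"
    unfolding card_cartesian_product card_vec_components prod_constant of_nat_power[symmetric] of_nat_mult[symmetric] of_nat_le_iff .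
  also have "\<dots> \<le> (3 * ?a) ^ CARD('n) * (3 * ?b)"
    using card_int_abs_le(2)[of ?a] card_int_abs_le(2)[of ?b] ab by (intro mult_mono power_mono) auto
  also have "\<dots> = 3 ^ (CARD('n) + 1) * (R powr (real CARD('n) * (1 - \<sigma>) + (1 - 2 * \<sigma>)))"
    using assms by (simp add: power_mult_distrib powr_add powr_powr powr_realpow[symmetric] mult.commute)
  finally show "real (card (lattice \<sigma> R \<inter> ball 0 R :: 'n pt set))
      \<le> 3 ^ (CARD('n) + 1) * R powr (real CARD('n) * (1 - \<sigma>) + (1 - 2 * \<sigma>))" .
qed

lemma lattice_ball_lower:
  assumes "R > 1" "0 < \<sigma>" "\<sigma> < 1 / 2" "0 < c" "c \<le> 1"
  shows "(c / (3 * real CARD('n))) ^ CARD('n) * (c / 3) * R powr (real CARD('n) * (1 - \<sigma>) + (1 - 2 * \<sigma>))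
    \<le> real (card (lattice \<sigma> R \<inter> ball 0 (c * R) :: 'n::finite pt set))"
proof -
  let ?n = "real CARD('n)"
  \<comment> \<open>The norm is bounded by the sum of the coordinates: the first n contribute at
    most c R / 3 together and the last one at most c R / 3, which leaves room for the strict
    inequality of the open ball.\<close>
  let ?a = "c / (3 * ?n) * R powr (1 - \<sigma>)" and ?b = "c / 3 * R powr (1 - 2 * \<sigma>)"
  let ?I = "\<lambda>a. {m :: int. \<bar>real_of_int m\<bar> \<le> a}"
  have ab: "?a \<ge> 0" "?b \<ge> 0" using assms by auto
  let ?J = "{m :: int ^ 'n. \<forall>j. m $ j \<in> ?I ?a} \<times> ?I ?b"
  have sub: "lattice_pt \<sigma> R ` ?J \<subseteq> lattice \<sigma> R \<inter> ball 0 (c * R)"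
  proof (rule image_subsetI)
    fix mk assume mk: "mk \<in> ?J"
    obtain m k where mk_eq: "mk = (m, k)" by force
    have m: "\<bar>real_of_int (m $ j)\<bar> \<le> ?a" and k: "\<bar>real_of_int k\<bar> \<le> ?b" for j
      using mk by (auto simp: mk_eq)
    have lat: "lattice_pt \<sigma> R (m, k) \<in> lattice \<sigma> R" by (simp add: lattice_eq_range)
    have *: "\<bar>real_of_int k * R powr s\<bar> \<le> t * R" if "\<bar>real_of_int k\<bar> \<le> t * R powr (1 - s)" for k s t
    proof -
      have "\<bar>real_of_int k\<bar> * R powr s \<le> t * R powr (1 - s) * R powr s"
        using that by (rule mult_right_mono) simp
      also have "\<dots> = t * R" using assms by (simp add: mult.assoc powr_add[symmetric])
      finally show ?thesis by (simp add: abs_mult)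
    qed
    have "norm (lattice_pt \<sigma> R (m, k)) \<le> ?n * (c / (3 * ?n) * R) + c / 3 * R"
      using *[OF m] *[OF k] by (intro norm_pt_le) (simp_all add: lattice_pt_def)
    also have "\<dots> < c * R" using assms by (simp add: field_simps)
    finally show "lattice_pt \<sigma> R mk \<in> lattice \<sigma> R \<inter> ball 0 (c * R)" using lat by (simp add: mk_eq)
  qed
  have "lattice \<sigma> R \<inter> ball 0 (c * R) \<subseteq> (lattice \<sigma> R \<inter> ball 0 R :: 'n pt set)"
    using assms subset_ball[of "c * R" R 0] by auto
  then have "finite (lattice \<sigma> R \<inter> ball 0 (c * R) :: 'n pt set)"
    using lattice_ball_upper(1) assms finite_subset by blast
  from card_mono[OF this sub] have "card ?J \<le> card (lattice \<sigma> R \<inter> ball 0 (c * R) :: 'n pt set)"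
    using assms by (subst (asm) card_image) (auto intro: inj_on_subset[OF inj_lattice_pt])
  then have 1: "real (card (?I ?a)) ^ CARD('n) * real (card (?I ?b)) \<le> real (card (lattice \<sigma> R \<inter> ball 0 (c * R) :: 'n pt set))"
    unfolding card_cartesian_product card_vec_components prod_constant of_nat_power[symmetric] of_nat_mult[symmetric] of_nat_le_iff .
  have "(c / (3 * ?n)) ^ CARD('n) * (c / 3) * R powr (?n * (1 - \<sigma>) + (1 - 2 * \<sigma>)) = ?a ^ CARD('n) * ?b"
    using assms unfolding power_mult_distrib powr_add
    by (simp add: powr_powr powr_realpow[symmetric] mult.commute)
  also have "\<dots> \<le> real (card (?I ?a)) ^ CARD('n) * real (card (?I ?b))"
    using card_int_abs_le(3)[OF ab(1)] card_int_abs_le(3)[OF ab(2)] ab by (intro mult_mono power_mono) auto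
  also note 1
  finally show ?thesis .
qed

text \<open>The part of X where the phases are under control. The single parameter c limits both
  sources of error: the distance of x to the lattice point y, and the size of y, by which the width
  1 / R of the boxes gets multiplied.\<close>

definition X_core :: "real \<Rightarrow> real \<Rightarrow> real \<Rightarrow> 'n::finite pt set" where
  "X_core c \<sigma> R = (\<Union>y \<in> lattice \<sigma> R \<inter> ball 0 (c * R). ball y c)"

lemma open_X_set: "open (X_set \<sigma> R)" "open (X_core c \<sigma> R)"
  unfolding X_set_def X_core_def by auto

lemma X_core_subset:
  assumes "R > 0" "0 < c" "c \<le> 1"
  shows "X_core c \<sigma> R \<subseteq> X_set \<sigma> R"
proof -
  have "ball 0 (c * R) \<subseteq> ball (0 :: 'a pt) R" using assms by (intro subset_ball) auto
  moreover have "ball y c \<subseteq> ball y 1" for y :: "'a pt" using assms by (intro subset_ball) auto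
  ultimately show ?thesis unfolding X_core_def X_set_def by (intro UN_mono) auto
qed

lemma ball_fmeasurable: "ball x r \<in> fmeasurable (lborel :: 'a::euclidean_space measure)"
  by (simp add: fmeasurable_def emeasure_lborel_ball_finite[unfolded infinity_ennreal_def])

text \<open>Subadditivity suffices, so it does not matter that the unit balls may overlap for R near
  1.\<close>

lemma measure_X_set_le:
  assumes "R > 1" "0 < \<sigma>" "\<sigma> < 1 / 2"
  shows "X_set \<sigma> R \<in> fmeasurable (lborel :: 'n::finite pt measure)"
    and "measure lborel (X_set \<sigma> R :: 'n pt set) \<le>
      3 ^ (CARD('n) + 1) * measure lborel (ball (0 :: 'n pt) 1) * R powr (real CARD('n) * (1 - \<sigma>) + (1 - 2 * \<sigma>))"
proof -
  note fin = lattice_ball_upper[OF assms, where 'n = 'n]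
  show "X_set \<sigma> R \<in> fmeasurable (lborel :: 'n pt measure)"
    unfolding X_set_def using fin(1)
    by (intro fmeasurable.finite_UN) (auto intro: ball_fmeasurable)
  have "measure lborel (X_set \<sigma> R :: 'n pt set) \<le> (\<Sum>y\<in>lattice \<sigma> R \<inter> ball 0 R. measure lborel (ball (y :: 'n pt) 1))"
    unfolding X_set_def by (rule measure_UNION_le) (use fin in auto)
  also have "\<dots> = (\<Sum>y\<in>(lattice \<sigma> R \<inter> ball 0 R :: 'n pt set). measure lborel (ball (0 :: 'n pt) 1))"
    by (intro sum.cong refl) (use content_ball_conv_unit_ball[where 'a = "'n pt", of 1] in simp)
  also have "\<dots> = real (card (lattice \<sigma> R \<inter> ball 0 R :: 'n pt set)) * measure lborel (ball (0 :: 'n pt) 1)"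
    by simp
  also have "\<dots> \<le> 3 ^ (CARD('n) + 1) * R powr (real CARD('n) * (1 - \<sigma>) + (1 - 2 * \<sigma>)) * measure lborel (ball (0 :: 'n pt) 1)"
    using fin(2) by (rule mult_right_mono) simp
  finally show "measure lborel (X_set \<sigma> R :: 'n pt set) \<le>
      3 ^ (CARD('n) + 1) * measure lborel (ball (0 :: 'n pt) 1) * R powr (real CARD('n) * (1 - \<sigma>) + (1 - 2 * \<sigma>))"
    by (simp add: mult_ac)
qed

text \<open>Lattice points are 1-separated, so balls of radius c \<le> 1/2 are disjoint and their
  volumes add up.\<close>

lemma measure_X_core_ge:
  assumes "R > 1" "0 < \<sigma>" "\<sigma> < 1 / 2" "0 < c" "c \<le> 1 / 2"
  shows "(c / (3 * real CARD('n))) ^ CARD('n) * (c / 3) * c ^ (CARD('n) + 1) * measure lborel (ball (0 :: 'n pt) 1)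
      * R powr (real CARD('n) * (1 - \<sigma>) + (1 - 2 * \<sigma>)) \<le> measure lborel (X_core c \<sigma> R :: 'n::finite pt set)"
proof -
  have "lattice \<sigma> R \<inter> ball 0 (c * R) \<subseteq> (lattice \<sigma> R \<inter> ball 0 R :: 'n pt set)"
    using assms subset_ball[of "c * R" R 0] by auto
  then have fin: "finite (lattice \<sigma> R \<inter> ball 0 (c * R) :: 'n pt set)"
    using lattice_ball_upper(1) assms finite_subset by blast
  have disj: "disjoint_family_on (\<lambda>y. ball y c) (lattice \<sigma> R \<inter> ball 0 (c * R) :: 'n pt set)"
  proof (unfold disjoint_family_on_def, intro ballI impI)
    fix y z :: "'n pt" assume "y \<in> lattice \<sigma> R \<inter> ball 0 (c * R)" "z \<in> lattice \<sigma> R \<inter> ball 0 (c * R)" "y \<noteq> z"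
    then have "1 \<le> dist y z" using lattice_separated[of R \<sigma> y z] assms by (simp add: dist_norm)
    then show "ball y c \<inter> ball z c = {}" using assms by (intro disjoint_ballI) auto
  qed
  have "measure lborel (X_core c \<sigma> R :: 'n pt set) = (\<Sum>y\<in>lattice \<sigma> R \<inter> ball 0 (c * R). measure lborel (ball (y :: 'n pt) c))"
    unfolding X_core_def using fin disj
    by (intro measure_finite_Union) (auto simp: emeasure_lborel_ball_finite[unfolded infinity_ennreal_def] less_top)
  also have "\<dots> = (\<Sum>y\<in>(lattice \<sigma> R \<inter> ball 0 (c * R) :: 'n pt set). c ^ (CARD('n) + 1) * measure lborel (ball (0 :: 'n pt) 1))"
    by (intro sum.cong refl) (use content_ball_conv_unit_ball[where 'a = "'n pt", of c] assms in simp)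
  also have "\<dots> = real (card (lattice \<sigma> R \<inter> ball 0 (c * R) :: 'n pt set)) * (c ^ (CARD('n) + 1) * measure lborel (ball (0 :: 'n pt) 1))"
    by simp
  also have "\<dots> \<ge> ((c / (3 * real CARD('n))) ^ CARD('n) * (c / 3) * R powr (real CARD('n) * (1 - \<sigma>) + (1 - 2 * \<sigma>)))
      * (c ^ (CARD('n) + 1) * measure lborel (ball (0 :: 'n pt) 1))"
    using lattice_ball_lower[of R \<sigma> c, where 'n = 'n] assms by (intro mult_right_mono) auto
  finally show ?thesis by (simp add: mult_ac)
qed

section \<open>The size of the solution on the lattice neighbourhood\<close>

definition lift_pt :: "real ^ 'n::finite \<Rightarrow> 'n pt" where
  "lift_pt a = (a, (norm a)\<^sup>2)"

definition freq_pt :: "real \<Rightarrow> real \<Rightarrow> int ^ 'n::finite \<Rightarrow> real ^ 'n" where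
  "freq_pt \<sigma> R l = (\<chi> j. real_of_int (l $ j) * R powr (- \<sigma>))"

lemma paraboloidD:
  assumes "\<xi> \<in> paraboloid"
  shows "fst \<xi> \<in> unit_cube" "\<xi> = lift_pt (fst \<xi>)"
  using assms by (auto simp: paraboloid_def unit_cube_def lift_pt_def prod_eq_iff)

text \<open>The last coordinate contributes (|a| - |b|) (|a| + |b|), at most n \<delta> * 2 n. The
  remaining ones contribute n \<delta>, and n \<le> n^2 merges the two terms.\<close>

lemma lift_pt_dist_le:
  fixes a b :: "real ^ 'n::finite"
  assumes "a \<in> unit_cube" "b \<in> unit_cube" "\<And>j. \<bar>a $ j - b $ j\<bar> \<le> \<delta>"
  shows "norm (lift_pt a - lift_pt b) \<le> 3 * (real CARD('n))\<^sup>2 * \<delta>"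
proof -
  let ?n = "real CARD('n)"
  \<comment> \<open>Any coordinate will do; index types are nonempty, so \<open>undefined\<close>
    names one.\<close>
  have \<delta>: "\<delta> \<ge> 0" using assms(3)[of undefined] by linarith
  have ab: "norm (a - b) \<le> ?n * \<delta>" using assms(3) by (intro norm_le_CARD) simp
  have le: "norm a \<le> ?n" "norm b \<le> ?n"
    using norm_le_CARD[of a 1] norm_le_CARD[of b 1] assms by (auto simp: unit_cube_def)
  have "\<bar>(norm a)\<^sup>2 - (norm b)\<^sup>2\<bar> = \<bar>norm a - norm b\<bar> * (norm a + norm b)"
    by (simp add: power2_eq_square square_diff_square_factored abs_mult)
  also have "\<dots> \<le> (?n * \<delta>) * (?n + ?n)"
    using ab le norm_triangle_ineq3[of a b] \<delta> by (intro mult_mono) auto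
  finally have "norm (lift_pt a - lift_pt b) \<le> ?n * \<delta> + ?n * \<delta> * (?n + ?n)"
    using ab norm_Pair_le[of "a - b" "(norm a)\<^sup>2 - (norm b)\<^sup>2"] by (simp add: lift_pt_def)
  also have "\<dots> \<le> ?n\<^sup>2 * \<delta> + ?n * \<delta> * (?n + ?n)"
    using \<delta> self_le_power[of ?n 2] by (intro add_right_mono mult_right_mono) (auto simp: Suc_leI)
  also have "\<dots> = 3 * ?n\<^sup>2 * \<delta>" by (simp add: power2_eq_square algebra_simps)
  finally show ?thesis .
qed

lemma norm_lift_pt_le:
  fixes a :: "real ^ 'n::finite"
  assumes "a \<in> unit_cube"
  shows "norm (lift_pt a) \<le> 3 * (real CARD('n))\<^sup>2"
  using lift_pt_dist_le[of a 0 1] assms by (simp add: unit_cube_def lift_pt_def)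

lemma freq_pt_in_unit_cube:
  assumes "R > 1" "l \<in> freqs \<sigma> R"
  shows "freq_pt \<sigma> R l \<in> unit_cube"
proof -
  have "\<bar>real_of_int (l $ j) * R powr (- \<sigma>)\<bar> \<le> 1" for j
  proof -
    have l: "1 \<le> l $ j" "real_of_int (l $ j) < R powr \<sigma>" using assms by (auto simp: freqs_def)
    then have "real_of_int (l $ j) * R powr (- \<sigma>) \<le> R powr \<sigma> * R powr (- \<sigma>)"
      by (intro mult_right_mono) auto
    with l show ?thesis using assms by (simp add: powr_add[symmetric])
  qed
  then show ?thesis by (simp add: freq_pt_def unit_cube_def)
qed

text \<open>The arithmetic behind the example: the powers of R cancel and leave m . l + k |l|^2 with
  integer entries. The last direction is scaled by R^(2 \<sigma>) because the frequency enters it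
  quadratically.\<close>

lemma lattice_inner_Ints:
  fixes y :: "'n::finite pt"
  assumes "R > 0" "y \<in> lattice \<sigma> R"
  shows "y \<bullet> lift_pt (freq_pt \<sigma> R l) \<in> \<int>"
proof -
  obtain m k where y: "y = ((\<chi> j. real_of_int (m $ j) * R powr \<sigma>), real_of_int k * R powr (2 * \<sigma>))"
    using assms by (auto simp: lattice_def)
  have "R powr \<sigma> * R powr (- \<sigma>) = 1" "R powr (2 * \<sigma>) * (R powr (- \<sigma>) * R powr (- \<sigma>)) = 1"
    using assms by (simp_all add: powr_add[symmetric])
  then have 1: "(a * R powr \<sigma>) * (b * R powr (- \<sigma>)) = a * b"
    "(a * R powr (2 * \<sigma>)) * ((b * R powr (- \<sigma>)) * (b * R powr (- \<sigma>))) = a * (b * b)" for a b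
    by (metis mult.assoc mult.left_commute mult.right_neutral)+
  have "y \<bullet> lift_pt (freq_pt \<sigma> R l) = (\<Sum>j\<in>UNIV. real_of_int (m $ j) * real_of_int (l $ j))
      + (\<Sum>j\<in>UNIV. real_of_int k * (real_of_int (l $ j) * real_of_int (l $ j)))"
    by (simp add: y lift_pt_def freq_pt_def inner_vec_def power2_norm_eq_inner sum_distrib_left 1)
  also have "\<dots> \<in> \<int>" by (intro Ints_add Ints_sum Ints_mult) auto
  finally show ?thesis .
qed

lemma integrable_h_fun: "integrable surface_measure (h_fun \<sigma> R :: 'n::finite pt \<Rightarrow> real)"
  by (rule integrable_surface_measure_bounded[OF h_fun_measurable, where B = "real (card (freqs \<sigma> R :: (int ^ 'n) set))"])
    (simp add: abs_of_nonneg h_fun_nonneg h_fun_le_card)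

text \<open>With y a lattice point near x and p the lifted centre of the box of \<xi>, x . \<xi> - y
  . p = y . (\<xi> - p) + (x - y) . \<xi>. For c = 1 / (48 n^2) the terms are at most (c R) (3 n^2 /
  R) = 1/16 and c * 3 n^2 = 1/16, together the 1/8 that \<open>norm_extension_ge\<close>
  tolerates.\<close>

lemma norm_g_fun_ge:
  fixes x :: "'n::finite pt"
  assumes "R > 1" "x \<in> X_core (1 / (48 * (real CARD('n))\<^sup>2)) \<sigma> R"
  shows "(LINT \<xi>|surface_measure. h_fun \<sigma> R (\<xi> :: 'n pt)) / 2 \<le> norm (g_fun \<sigma> R x)"
  unfolding g_fun_def
proof (rule norm_extension_ge[where t = 0])
  show "integrable surface_measure (h_fun \<sigma> R :: 'n pt \<Rightarrow> real)"
    by (rule integrable_h_fun)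
  show "0 \<le> h_fun \<sigma> R \<xi>" for \<xi> :: "'n pt" by (rule h_fun_nonneg)
  let ?n = "real CARD('n)" and ?c = "1 / (48 * (real CARD('n))\<^sup>2)"
  fix \<xi> :: "'n pt" assume \<xi>: "\<xi> \<in> paraboloid" "h_fun \<sigma> R \<xi> \<noteq> 0"
  from \<xi>(2) obtain l where l: "l \<in> freqs \<sigma> R" "fst \<xi> \<in> freq_box \<sigma> R l" by (rule h_fun_ne_zeroE)
  obtain y where y: "y \<in> lattice \<sigma> R" "norm y < ?c * R" "norm (x - y) < ?c"
  proof -
    obtain y where "y \<in> lattice \<sigma> R" "y \<in> ball 0 (?c * R)" "x \<in> ball y ?c"
      using assms(2) unfolding X_core_def by blast
    then show thesis using that[of y] unfolding mem_ball dist_norm norm_minus_commute[of y x] by simp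
  qed
  let ?p = "lift_pt (freq_pt \<sigma> R l)"
  have "norm (\<xi> - ?p) \<le> 3 * ?n\<^sup>2 * (1 / R)"
    using paraboloidD[OF \<xi>(1)] freq_pt_in_unit_cube[OF assms(1) l(1)] l(2)
      lift_pt_dist_le[of "fst \<xi>" "freq_pt \<sigma> R l" "1 / R"]
    by (simp add: mem_freq_box_iff freq_pt_def less_imp_le)
  then have "norm y * norm (\<xi> - ?p) \<le> (?c * R) * (3 * ?n\<^sup>2 * (1 / R))"
    using y assms(1) by (intro mult_mono) auto
  also have "\<dots> = 1 / 16" using assms(1) by simp
  finally have 1: "\<bar>y \<bullet> (\<xi> - ?p)\<bar> \<le> 1 / 16"
    using Cauchy_Schwarz_ineq2[of y "\<xi> - ?p"] by linarith
  have "norm \<xi> \<le> 3 * ?n\<^sup>2"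
    using norm_lift_pt_le paraboloidD[OF \<xi>(1)] by metis
  then have "norm (x - y) * norm \<xi> \<le> ?c * (3 * ?n\<^sup>2)"
    using y by (intro mult_mono) auto
  also have "\<dots> = 1 / 16" by simp
  finally have 2: "\<bar>(x - y) \<bullet> \<xi>\<bar> \<le> 1 / 16"
    using Cauchy_Schwarz_ineq2[of "x - y" \<xi>] by linarith
  have "x \<bullet> \<xi> - y \<bullet> ?p = y \<bullet> (\<xi> - ?p) + (x - y) \<bullet> \<xi>"
    by (simp add: inner_diff_left inner_diff_right)
  then have "\<bar>x \<bullet> \<xi> - 0 - y \<bullet> ?p\<bar> \<le> 1 / 8" using 1 2 by linarith
  then show "\<exists>k\<in>\<int>. \<bar>x \<bullet> \<xi> - 0 - k\<bar> \<le> 1 / 8"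
    using lattice_inner_Ints[OF _ y(1)] assms(1) by (intro bexI) auto
qed

lemma integral_h_fun_bounds:
  assumes "R > 1" "\<sigma> > 0"
  shows "(LINT \<xi>|surface_measure. h_fun \<sigma> R (\<xi> :: 'n::finite pt))
      \<le> (1 + 2 * real CARD('n)) * 2 ^ CARD('n) * R powr (real CARD('n) * (\<sigma> - 1))"
    and "R powr (real CARD('n) * (\<sigma> - 1)) / 2 ^ CARD('n) \<le> (LINT \<xi>|surface_measure. h_fun \<sigma> R (\<xi> :: 'n pt))"
proof -
  let ?n = "real CARD('n)" and ?K = "real (card (freqs \<sigma> R :: (int ^ 'n) set))"
  have eq: "(LINT \<xi>|surface_measure. h_fun \<sigma> R (\<xi> :: 'n pt)) =
      (\<Sum>l\<in>freqs \<sigma> R. measure surface_measure {\<xi> :: 'n pt. fst \<xi> \<in> freq_box \<sigma> R l})"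
    unfolding h_fun_eq by (rule integral_surface_measure_freq_indicators) simp
  have R: "R powr (?n * (\<sigma> - 1)) = R powr (?n * \<sigma>) * (1 / R) ^ CARD('n)"
    using assms by (simp add: right_diff_distrib powr_diff powr_realpow power_one_over)
  have "(LINT \<xi>|surface_measure. h_fun \<sigma> R (\<xi> :: 'n pt)) \<le> ?K * ((1 + 2 * ?n) * (2 / R) ^ CARD('n))"
    unfolding eq using measure_freq_box_bounds(1)[OF assms(1)] by (rule sum_bounded_above)
  also have "\<dots> \<le> R powr (?n * \<sigma>) * ((1 + 2 * ?n) * (2 / R) ^ CARD('n))"
    using freqs_card_bounds(1)[OF assms] assms by (intro mult_right_mono) auto
  finally show "(LINT \<xi>|surface_measure. h_fun \<sigma> R (\<xi> :: 'n pt))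
      \<le> (1 + 2 * ?n) * 2 ^ CARD('n) * R powr (?n * (\<sigma> - 1))"
    unfolding R by (simp add: power_divide mult_ac)
  have "R powr (?n * (\<sigma> - 1)) / 2 ^ CARD('n) \<le> ?K * (1 / R) ^ CARD('n)"
    using mult_right_mono[OF freqs_card_bounds(2)[OF assms, where 'n = 'n], of "(1 / R) ^ CARD('n)"] assms
    unfolding R by (simp add: field_simps)
  also have "\<dots> \<le> (LINT \<xi>|surface_measure. h_fun \<sigma> R (\<xi> :: 'n pt))"
    unfolding eq
  proof (rule sum_bounded_below)
    fix l :: "int ^ 'n" assume "l \<in> freqs \<sigma> R"
    then show "(1 / R) ^ CARD('n) \<le> measure surface_measure {\<xi> :: 'n pt. fst \<xi> \<in> freq_box \<sigma> R l}"
      using measure_freq_box_bounds(2)[OF assms(1)] measure_surface_measure_fst_bounds(1)[of "freq_box \<sigma> R l"]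
      by fastforce
  qed
  finally show "R powr (?n * (\<sigma> - 1)) / 2 ^ CARD('n) \<le> (LINT \<xi>|surface_measure. h_fun \<sigma> R (\<xi> :: 'n pt))" .
qed

section \<open>Rules for comparability\<close>

lemma comparable_mono: "comparable C a b \<Longrightarrow> C \<le> C' \<Longrightarrow> 0 \<le> a \<Longrightarrow> 0 \<le> b \<Longrightarrow> comparable C' a b"
  unfolding comparable_def by (meson mult_right_mono order_trans)

lemma comparable_sym: "comparable C a b \<longleftrightarrow> comparable C b a"
  by (auto simp: comparable_def)

lemma comparable_trans:
  assumes "comparable C a b" "comparable C' b c" "0 \<le> C" "0 \<le> C'"
  shows "comparable (C * C') a c"
  unfolding comparable_def
proof
  show "a \<le> C * C' * c"
    using assms mult_left_mono[of b "C' * c" C] by (auto simp: comparable_def mult.assoc)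
  show "c \<le> C * C' * a"
    using assms mult_left_mono[of b "C * a" C'] by (auto simp: comparable_def mult_ac)
qed

lemma comparable_mult:
  assumes "comparable C a b" "comparable C' a' b'" "0 \<le> a" "0 \<le> b" "0 \<le> a'" "0 \<le> b'"
  shows "comparable (C * C') (a * a') (b * b')"
  using assms mult_mono[of a "C * b" a' "C' * b'"] mult_mono[of b "C * a" b' "C' * a'"]
  by (auto simp: comparable_def mult_ac)

lemma comparable_powr:
  assumes "comparable C a b" "0 \<le> C" "0 \<le> a" "0 \<le> b" "0 \<le> q"
  shows "comparable (C powr q) (a powr q) (b powr q)"
  using assms powr_mono2[of q a "C * b"] powr_mono2[of q b "C * a"]
  by (auto simp: comparable_def powr_mult)

lemma comparableI_bounds:
  assumes "a \<le> C1 * b" "c2 * b \<le> a" "c2 > 0" "0 \<le> a" "0 \<le> b"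
  shows "comparable (max C1 (1 / c2)) a b"
proof -
  have "b \<le> (1 / c2) * a" using assms by (simp add: field_simps)
  also have "\<dots> \<le> max C1 (1 / c2) * a" using assms by (intro mult_right_mono) auto
  finally have "b \<le> max C1 (1 / c2) * a" .
  moreover have "C1 * b \<le> max C1 (1 / c2) * b" using assms by (intro mult_right_mono) auto
  ultimately show ?thesis using assms by (auto simp: comparable_def)
qed

lemma measure_and_norm_on_X_set_comparable:
  assumes "0 < \<sigma>" "\<sigma> < 1 / 2" "p > 0"
  shows "\<exists>C>0. \<forall>R>1. comparable C (measure lborel (X_set \<sigma> R :: 'n::finite pt set))
    (R powr (real CARD('n) * (1 - \<sigma>) + (1 - 2 * \<sigma>)))"
    and "\<exists>C>0. \<forall>R>1. comparable C (Lp_norm p (restrict_space lborel (X_set \<sigma> R)) (g_fun \<sigma> R :: 'n pt \<Rightarrow> complex))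
    (R powr (real CARD('n) * (\<sigma> - 1)) * measure lborel (X_set \<sigma> R :: 'n pt set) powr (1 / p))"
proof -
  let ?n = "real CARD('n)"
  define E where "E = ?n * (1 - \<sigma>) + (1 - 2 * \<sigma>)"
  define V where "V = measure lborel (ball (0 :: 'n pt) 1)"
  define c where "c = 1 / (48 * ?n\<^sup>2)"
  have "1 \<le> ?n\<^sup>2" by (simp add: Suc_leI)
  then have "1 * 2 \<le> 48 * ?n\<^sup>2" by linarith
  then have c: "0 < c" "c \<le> 1 / 2" unfolding c_def by (auto intro!: divide_left_mono[of 2 "48 * ?n\<^sup>2" 1, simplified])
  have V: "V > 0" unfolding V_def by (rule content_ball_pos) simp
  define b1 where "b1 = (c / (3 * ?n)) ^ CARD('n) * (c / 3) * c ^ (CARD('n) + 1) * V"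
  have b1: "b1 > 0" using c V by (simp add: b1_def)
  define B1 where "B1 = 3 ^ (CARD('n) + 1) * V"
  have B1: "B1 > 0" using V by (simp add: B1_def)
  define X where "X R = (X_set \<sigma> R :: 'n pt set)" for R
  define Y where "Y R = (X_core c \<sigma> R :: 'n pt set)" for R
  have X: "X R \<in> fmeasurable lborel" "measure lborel (X R) \<le> B1 * R powr E" if "R > 1" for R
    using measure_X_set_le[OF that assms(1,2), where 'n = 'n] by (auto simp: X_def B1_def V_def E_def)
  have Y: "b1 * R powr E \<le> measure lborel (Y R)" if "R > 1" for R
    using measure_X_core_ge[OF that assms(1,2) c, where 'n = 'n] by (simp add: Y_def b1_def V_def E_def)
  have YX: "Y R \<subseteq> X R" if "R > 1" for R
    using X_core_subset[of R c \<sigma>] that c by (simp add: X_def Y_def)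
  have Ysets: "Y R \<in> sets lborel" "X R \<in> sets lborel" for R
    using open_X_set[THEN borel_open] by (auto simp: X_def Y_def)
  \<comment> \<open>The core lies in X, so its volume bounds that of X from below.\<close>
  have YXm: "measure lborel (Y R) \<le> measure lborel (X R)" if "R > 1" for R
    using X[OF that] YX[OF that] Ysets by (intro measure_mono_fmeasurable) auto
  have "comparable (max B1 (1 / b1)) (measure lborel (X R)) (R powr E)" if "R > 1" for R
    using X[OF that] Y[OF that] YXm[OF that] b1 by (intro comparableI_bounds) auto
  then show "\<exists>C>0. \<forall>R>1. comparable C (measure lborel (X_set \<sigma> R :: 'n pt set)) (R powr (?n * (1 - \<sigma>) + (1 - 2 * \<sigma>)))"
    using B1 unfolding X_def E_def by (intro exI[of _ "max B1 (1 / b1)"]) auto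
  define B2 where "B2 = (1 + 2 * ?n) * 2 ^ CARD('n)"
  define b2 where "b2 = (1 / 2 ^ CARD('n) / 2 :: real)"
  \<comment> \<open>The core fills at least this fraction of X, since its volume is at least b1 R^E
    while that of X is at most B1 R^E.\<close>
  define b3 where "b3 = b1 / B1"
  have pos: "B2 > 0" "b2 > 0" "b3 > 0" using b1 B1 by (auto simp: B2_def b2_def b3_def)
  have "comparable (max B2 (1 / (b2 * b3 powr (1 / p)))) (Lp_norm p (restrict_space lborel (X R)) (g_fun \<sigma> R))
      (R powr (?n * (\<sigma> - 1)) * measure lborel (X R) powr (1 / p))" if R: "R > 1" for R
  proof -
    let ?N = "restrict_space lborel (X R)" and ?r = "R powr (?n * (\<sigma> - 1))" and ?m = "measure lborel (X R)"
    interpret finite_measure ?N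
      using X[OF R] by (intro finite_measureI) (simp add: emeasure_restrict_space space_restrict_space fmeasurable_def less_top)
    have mN: "measure ?N Z = measure lborel Z" if "Z \<subseteq> X R" "Z \<in> sets borel" for Z
      using that Ysets by (intro measure_restrict_space) auto
    have "g_fun \<sigma> R \<in> borel_measurable (borel :: 'n pt measure)"
      unfolding g_fun_def by (rule extension_measurable[OF h_fun_measurable])
    then have g: "g_fun \<sigma> R \<in> borel_measurable ?N"
      by (intro measurable_restrict_space1) simp
    have gB: "norm (g_fun \<sigma> R x) \<le> B2 * ?r" for x :: "'n pt"
      using norm_extension_le[OF h_fun_nonneg] integral_h_fun_bounds(1)[OF R assms(1), where 'n = 'n]
      unfolding g_fun_def B2_def by (rule order_trans)
    have gb: "b2 * ?r \<le> norm (g_fun \<sigma> R x)" if "x \<in> Y R" for x :: "'n pt"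
      using norm_g_fun_ge[OF R, of x \<sigma>] that integral_h_fun_bounds(2)[OF R assms(1), where 'n = 'n]
      unfolding Y_def c_def b2_def by simp
    let ?I = "LINT x|?N. norm (g_fun \<sigma> R x) powr p"
    have I0: "0 \<le> ?I" by (intro Bochner_Integration.integral_nonneg) auto
    have "?I \<le> (B2 * ?r) powr p * ?m"
      using integral_norm_powr_bounds(1)[OF g assms(3) gB] mN[of "X R"] Ysets
      by (simp add: space_restrict_space)
    then have "?I powr (1 / p) \<le> ((B2 * ?r) powr p * ?m) powr (1 / p)"
      using I0 assms(3) by (intro powr_mono2) auto
    also have "\<dots> = B2 * (?r * ?m powr (1 / p))"
      using pos assms(3) by (simp add: powr_mult powr_powr)
    finally have upper: "Lp_norm p ?N (g_fun \<sigma> R) \<le> B2 * (?r * ?m powr (1 / p))"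
      by (simp add: Lp_norm_def)
    have "b3 * ?m \<le> measure lborel (Y R)"
    proof -
      have "b3 * ?m \<le> b3 * (B1 * R powr E)" using X[OF R] pos by (intro mult_left_mono) auto
      also have "\<dots> = b1 * R powr E" using B1 by (simp add: b3_def)
      finally show ?thesis using Y[OF R] by linarith
    qed
    then have "(b2 * ?r) powr p * (b3 * ?m) \<le> (b2 * ?r) powr p * measure lborel (Y R)"
      by (intro mult_left_mono) auto
    also have "\<dots> \<le> ?I"
      using integral_norm_powr_bounds(2)[OF g assms(3) gB, of "Y R" "b2 * ?r"] gb mN[of "Y R"] Ysets YX[OF R] pos
      by (auto simp: sets_restrict_space_iff)
    finally have "((b2 * ?r) powr p * (b3 * ?m)) powr (1 / p) \<le> ?I powr (1 / p)"
      using assms(3) pos by (intro powr_mono2) auto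
    moreover have "((b2 * ?r) powr p * (b3 * ?m)) powr (1 / p) = (b2 * b3 powr (1 / p)) * (?r * ?m powr (1 / p))"
      using pos assms(3) by (simp add: powr_mult powr_powr)
    ultimately have lower: "(b2 * b3 powr (1 / p)) * (?r * ?m powr (1 / p)) \<le> Lp_norm p ?N (g_fun \<sigma> R)"
      by (simp add: Lp_norm_def)
    show ?thesis
      using upper lower pos by (intro comparableI_bounds) (auto simp: Lp_norm_def)
  qed
  then show "\<exists>C>0. \<forall>R>1. comparable C (Lp_norm p (restrict_space lborel (X_set \<sigma> R)) (g_fun \<sigma> R :: 'n pt \<Rightarrow> complex))
    (R powr (real CARD('n) * (\<sigma> - 1)) * measure lborel (X_set \<sigma> R :: 'n pt set) powr (1 / p))"
    using pos unfolding X_def by (intro exI[of _ "max B2 (1 / (b2 * b3 powr (1 / p)))"]) auto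
qed

section \<open>Caps and frequency boxes\<close>

text \<open>Packing: a cube of side s that contains a point within \<rho> of b lies in the cube of
  half-side \<rho> + s around b. Disjointness then bounds the number by the quotient of the
  volumes.\<close>

lemma card_cap_cubes_le:
  fixes \<Theta> :: "(real ^ 'n::finite) set"
  assumes disj: "disjoint_family_on (cap_cube R) \<Theta>" and "R > 0" "\<rho> \<ge> 0"
    and meets: "\<And>c. c \<in> \<Theta> \<Longrightarrow> \<exists>\<xi>\<in>cap_cube R c. \<forall>j. \<bar>\<xi> $ j - b $ j\<bar> \<le> \<rho>"
  shows "finite \<Theta> \<and> real (card \<Theta>) \<le> (2 * (\<rho> / R powr (- 1 / 2) + 1)) ^ CARD('n)"
proof -
  define s where "s = R powr (- 1 / 2)"
  have s: "s > 0" using assms by (simp add: s_def)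
  let ?B = "\<lambda>c :: real ^ 'n. box (\<chi> j. c $ j - s / 2) (\<chi> j. c $ j + s / 2)"
  let ?C = "box (\<chi> j. b $ j - (\<rho> + s)) (\<chi> j. b $ j + (\<rho> + s))"
  have sub: "?B c \<subseteq> cap_cube R c" for c
    unfolding cap_cube_def s_def[symmetric] by (auto simp: mem_box_cart less_imp_le)
  have mB: "measure lborel (?B c) = s ^ CARD('n)" for c
    using s by (subst emeasure_lborel_box_cart) auto
  have mC: "measure lborel ?C = (2 * (\<rho> + s)) ^ CARD('n)"
    using s assms by (subst emeasure_lborel_box_cart) auto
  \<comment> \<open>Finiteness of \<open>\<Theta>\<close> is part of the claim, so volumes are first
    compared for finite subfamilies; a common bound for these makes the whole family finite.\<close>
  have bound: "real (card G) \<le> (2 * (\<rho> / s + 1)) ^ CARD('n)" if G: "G \<subseteq> \<Theta>" "finite G" for G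
  proof -
    have disjB: "disjoint_family_on ?B G"
      using disj G sub unfolding disjoint_family_on_def by blast
    have "real (card G) * s ^ CARD('n) = (\<Sum>c\<in>G. measure lborel (?B c))" by (simp add: mB)
    also have "\<dots> = measure lborel (\<Union>c\<in>G. ?B c)"
      using G(2) disjB by (intro measure_finite_Union[symmetric]) (auto simp: emeasure_lborel_box_cart s less_imp_le)
    also have "\<dots> \<le> measure lborel ?C"
    proof (rule measure_mono_fmeasurable)
      show "(\<Union>c\<in>G. ?B c) \<subseteq> ?C"
      proof (rule UN_least)
        fix c assume "c \<in> G"
        then obtain \<xi> where \<xi>: "\<xi> \<in> cap_cube R c" "\<forall>j. \<bar>\<xi> $ j - b $ j\<bar> \<le> \<rho>" using meets G by blast
        show "?B c \<subseteq> ?C"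
        proof
          fix x assume x: "x \<in> ?B c"
          have "b $ j - (\<rho> + s) < x $ j \<and> x $ j < b $ j + (\<rho> + s)" for j
          proof -
            have "c $ j - s / 2 < x $ j" "x $ j < c $ j + s / 2" using x by (auto simp: mem_box_cart)
            moreover have "c $ j - s / 2 \<le> \<xi> $ j" "\<xi> $ j < c $ j + s / 2"
              using \<xi>(1) by (auto simp: cap_cube_def s_def)
            moreover have "\<bar>\<xi> $ j - b $ j\<bar> \<le> \<rho>" using \<xi>(2) by blast
            ultimately show ?thesis by linarith
          qed
          then show "x \<in> ?C" by (simp add: mem_box_cart)
        qed
      qed
    qed (use G(2) in auto)
    also have "\<dots> = (2 * (\<rho> / s + 1) * s) ^ CARD('n)" using s by (simp add: mC distrib_right)
    finally show ?thesis using s unfolding power_mult_distrib[of "2 * (\<rho> / s + 1)"] by simp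
  qed
  have "finite \<Theta> \<and> card \<Theta> \<le> nat \<lfloor>(2 * (\<rho> / s + 1)) ^ CARD('n)\<rfloor>"
    using bound by (intro finite_if_finite_subsets_card_bdd) (simp add: le_nat_floor)
  then show ?thesis using bound[OF subset_refl] unfolding s_def by simp
qed

definition caps_meeting :: "real \<Rightarrow> real \<Rightarrow> (real ^ 'n::finite) set \<Rightarrow> int ^ 'n \<Rightarrow> (real ^ 'n) set" where
  "caps_meeting \<sigma> R \<Theta> l = {c \<in> \<Theta>. cap_cube R c \<inter> freq_box \<sigma> R l \<noteq> {}}"

definition freqs_meeting :: "real \<Rightarrow> real \<Rightarrow> real ^ 'n::finite \<Rightarrow> (int ^ 'n) set" where
  "freqs_meeting \<sigma> R c = {l \<in> freqs \<sigma> R. cap_cube R c \<inter> freq_box \<sigma> R l \<noteq> {}}"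

definition capped :: "real \<Rightarrow> real \<Rightarrow> real ^ 'n::finite \<Rightarrow> 'n pt \<Rightarrow> real" where
  "capped \<sigma> R c = (\<lambda>\<xi>. indicator (cap R c) \<xi> * h_fun \<sigma> R \<xi>)"

lemma inverse_le_powr_half: "R > 1 \<Longrightarrow> 1 / R \<le> R powr (- 1 / 2)" for R :: real
  using powr_mono[of "- 1" "- 1 / 2" R] by (simp add: powr_minus_divide)

text \<open>Packing with \<rho> = 1 / R \<le> R^(-1/2): the quotient of \<rho> by the side of a cap
  is at most 1, and 2 (1 + 1) = 4.\<close>

lemma caps_meeting_bound:
  fixes \<Theta> :: "(real ^ 'n::finite) set"
  assumes "disjoint_family_on (cap_cube R) \<Theta>" "R > 1"
  shows "finite (caps_meeting \<sigma> R \<Theta> l)" "real (card (caps_meeting \<sigma> R \<Theta> l)) \<le> 4 ^ CARD('n)"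
proof -
  have *: "finite (caps_meeting \<sigma> R \<Theta> l) \<and>
      real (card (caps_meeting \<sigma> R \<Theta> l)) \<le> (2 * ((1 / R) / R powr (- 1 / 2) + 1)) ^ CARD('n)"
  proof (rule card_cap_cubes_le[where b = "freq_pt \<sigma> R l"])
    show "disjoint_family_on (cap_cube R) (caps_meeting \<sigma> R \<Theta> l)"
      using assms(1) by (rule disjoint_family_on_mono[rotated]) (auto simp: caps_meeting_def)
    fix c assume "c \<in> caps_meeting \<sigma> R \<Theta> l"
    then obtain \<xi> where "\<xi> \<in> cap_cube R c" "\<xi> \<in> freq_box \<sigma> R l" by (auto simp: caps_meeting_def)
    then show "\<exists>\<xi>\<in>cap_cube R c. \<forall>j. \<bar>\<xi> $ j - freq_pt \<sigma> R l $ j\<bar> \<le> 1 / R"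
      by (intro bexI[of _ \<xi>]) (auto simp: freq_pt_def mem_freq_box_iff less_imp_le)
  qed (use assms in auto)
  have "(2 * ((1 / R) / R powr (- 1 / 2) + 1)) ^ CARD('n) \<le> 4 ^ CARD('n)"
    using inverse_le_powr_half[OF assms(2)] assms(2) by (intro power_mono) (auto simp: field_simps)
  from order_trans[OF conjunct2[OF *] this] show "real (card (caps_meeting \<sigma> R \<Theta> l)) \<le> 4 ^ CARD('n)" .
  show "finite (caps_meeting \<sigma> R \<Theta> l)" using * by blast
qed

text \<open>The two centres are joined through a point of the cap in each box: one step of at most
  R^(-1/2) within the cap and two of at most 1 / R \<le> R^(-1/2) within the boxes.\<close>

lemma freqs_meeting_close:
  assumes "R > 1" "l \<in> freqs_meeting \<sigma> R c" "l' \<in> freqs_meeting \<sigma> R c"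
  shows "\<bar>real_of_int (l $ j) - real_of_int (l' $ j)\<bar> * R powr (- \<sigma>) \<le> 3 * R powr (- 1 / 2)"
proof -
  obtain x y where x: "x \<in> cap_cube R c" "x \<in> freq_box \<sigma> R l" and y: "y \<in> cap_cube R c" "y \<in> freq_box \<sigma> R l'"
    using assms unfolding freqs_meeting_def by blast
  have "\<bar>x $ j - y $ j\<bar> \<le> R powr (- 1 / 2)"
  proof -
    have "c $ j - R powr (- 1 / 2) / 2 \<le> x $ j" "x $ j < c $ j + R powr (- 1 / 2) / 2"
      "c $ j - R powr (- 1 / 2) / 2 \<le> y $ j" "y $ j < c $ j + R powr (- 1 / 2) / 2"
      using x(1) y(1) unfolding cap_cube_def by blast+
    then show ?thesis by linarith
  qed
  moreover have "\<bar>x $ j - real_of_int (l $ j) * R powr (- \<sigma>)\<bar> < 1 / R"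
    "\<bar>y $ j - real_of_int (l' $ j) * R powr (- \<sigma>)\<bar> < 1 / R"
    using x(2) y(2) by (auto simp: mem_freq_box_iff)
  ultimately have "\<bar>real_of_int (l $ j) * R powr (- \<sigma>) - real_of_int (l' $ j) * R powr (- \<sigma>)\<bar> \<le> 3 * R powr (- 1 / 2)"
    using inverse_le_powr_half[OF assms(1)] by linarith
  then show ?thesis by (simp add: abs_mult left_diff_distrib[symmetric])
qed

text \<open>As \<sigma> < 1/2, R^(-1/2) \<le> R^(-\<sigma>), so \<open>freqs_meeting_close\<close>
  confines each coordinate to distance 3 from a fixed integer, which leaves 7 values.\<close>

lemma freqs_meeting_bound:
  fixes c :: "real ^ 'n::finite"
  assumes "R > 1" "\<sigma> < 1 / 2"
  shows "finite (freqs_meeting \<sigma> R c)" "real (card (freqs_meeting \<sigma> R c)) \<le> 7 ^ CARD('n)"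
proof -
  show fin: "finite (freqs_meeting \<sigma> R c)" unfolding freqs_meeting_def by simp
  show "real (card (freqs_meeting \<sigma> R c)) \<le> 7 ^ CARD('n)"
  proof (cases "freqs_meeting \<sigma> R c = {}")
    case False
    then obtain l0 where l0: "l0 \<in> freqs_meeting \<sigma> R c" by blast
    let ?S = "{l :: int ^ 'n. \<forall>j. l $ j \<in> {l0 $ j - 3..l0 $ j + 3}}"
    have "freqs_meeting \<sigma> R c \<subseteq> ?S"
    proof
      fix l assume l: "l \<in> freqs_meeting \<sigma> R c"
      have "l $ j \<in> {l0 $ j - 3..l0 $ j + 3}" for j
      proof -
        have "\<bar>real_of_int (l $ j) - real_of_int (l0 $ j)\<bar> * R powr (- \<sigma>) \<le> 3 * R powr (- 1 / 2)"
          by (rule freqs_meeting_close[OF assms(1) l l0])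
        also have "\<dots> \<le> 3 * R powr (- \<sigma>)" using assms by simp
        finally have "\<bar>real_of_int (l $ j) - real_of_int (l0 $ j)\<bar> \<le> 3" using assms by simp
        then show ?thesis by simp linarith
      qed
      then show "l \<in> ?S" by blast
    qed
    then have "card (freqs_meeting \<sigma> R c) \<le> card ?S"
      by (intro card_mono finite_vec_components) auto
    also have "card ?S = 7 ^ CARD('n)" unfolding card_vec_components by simp
    finally have "real (card (freqs_meeting \<sigma> R c)) \<le> real (7 ^ CARD('n))" by (rule of_nat_mono)
    then show ?thesis by simp
  qed simp
qed

lemma cap_cube_borel [measurable]: "cap_cube R c \<in> sets borel"
proof -
  have "cap_cube R c = (\<Inter>j\<in>UNIV. {\<xi>. c $ j - R powr (- 1 / 2) / 2 \<le> \<xi> $ j} \<inter> {\<xi>. \<xi> $ j < c $ j + R powr (- 1 / 2) / 2})"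
    by (auto simp: cap_cube_def)
  also have "\<dots> \<in> sets borel"
    by (intro sets.finite_INT sets.Int borel_closed borel_open closed_Collect_le open_Collect_less continuous_intros) auto
  finally show ?thesis .
qed

lemma cap_borel [measurable]: "cap R c \<in> sets borel"
proof -
  have "cap R c = paraboloid \<inter> {\<xi>. fst \<xi> \<in> cap_cube R c}" by (auto simp: cap_def)
  also have "\<dots> \<in> sets borel" using fst_preimage_borel[OF cap_cube_borel] by (intro sets.Int) auto
  finally show ?thesis .
qed

lemma capped_measurable [measurable]: "capped \<sigma> R c \<in> borel_measurable borel"
  unfolding capped_def by measurable

lemma capped_nonneg: "0 \<le> capped \<sigma> R c \<xi>"
  by (simp add: capped_def h_fun_nonneg)

lemma integrable_capped: "integrable surface_measure (capped \<sigma> R (c :: real ^ 'n::finite))"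
proof (rule Bochner_Integration.integrable_bound[OF integrable_h_fun])
  show "AE \<xi> in surface_measure. norm (capped \<sigma> R c \<xi>) \<le> norm (h_fun \<sigma> R \<xi>)"
    by (auto simp: capped_def indicator_def)
qed (use capped_measurable in simp)

lemma capped_le:
  "capped \<sigma> R c \<xi> \<le> (\<Sum>l\<in>freqs_meeting \<sigma> R c. indicator (freq_box \<sigma> R l) (fst \<xi>))"
proof (cases "\<xi> \<in> cap R c")
  case True
  have "capped \<sigma> R c \<xi> = h_fun \<sigma> R \<xi>" using True by (simp add: capped_def)
  also have "h_fun \<sigma> R \<xi> = (\<Sum>l\<in>freqs_meeting \<sigma> R c. indicator (freq_box \<sigma> R l) (fst \<xi>))"
    unfolding h_fun_eq using True
    by (intro sum.mono_neutral_right) (auto simp: freqs_meeting_def cap_def indicator_def)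
  finally show ?thesis by simp
qed (auto simp: capped_def intro!: sum_nonneg)

lemma integral_capped_le:
  fixes c :: "real ^ 'n::finite"
  assumes "R > 1" "\<sigma> < 1 / 2"
  shows "(LINT \<xi>|surface_measure. capped \<sigma> R c \<xi>) \<le> 7 ^ CARD('n) * ((1 + 2 * real CARD('n)) * (2 / R) ^ CARD('n))"
proof -
  note F = freqs_meeting_bound[OF assms, of c]
  have "(LINT \<xi>|surface_measure. capped \<sigma> R c \<xi>) \<le>
      (LINT \<xi>|surface_measure. (\<Sum>l\<in>freqs_meeting \<sigma> R c. indicat_real (freq_box \<sigma> R l) (fst \<xi>)))"
    using F by (intro integral_mono integrable_capped integral_surface_measure_freq_indicators capped_le)
  also have "\<dots> \<le> real (card (freqs_meeting \<sigma> R c)) * ((1 + 2 * real CARD('n)) * (2 / R) ^ CARD('n))"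
    unfolding integral_surface_measure_freq_indicators(2)[OF F(1)]
    by (intro sum_bounded_above measure_freq_box_bounds assms)
  also have "\<dots> \<le> 7 ^ CARD('n) * ((1 + 2 * real CARD('n)) * (2 / R) ^ CARD('n))"
    using F assms by (intro mult_right_mono) auto
  finally show ?thesis .
qed

text \<open>Only one box is kept: on it \<open>h_fun\<close> is at least 1, and surface measure
  dominates the Lebesgue measure of the projection.\<close>

lemma integral_capped_ge:
  fixes c :: "real ^ 'n::finite"
  assumes "l \<in> freqs \<sigma> R"
  shows "measure lborel (cap_cube R c \<inter> freq_box \<sigma> R l \<inter> unit_cube) \<le> (LINT \<xi>|surface_measure. capped \<sigma> R c \<xi>)"
proof -
  interpret finite_measure "surface_measure :: 'n pt measure" by (rule finite_surface_measure)
  let ?B = "cap_cube R c \<inter> freq_box \<sigma> R l"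
  let ?P = "{\<xi> :: 'n pt. fst \<xi> \<in> ?B}"
  have P [measurable]: "?P \<in> sets borel" by (rule fst_preimage_borel) measurable
  have "measure lborel (?B \<inter> unit_cube) \<le> measure surface_measure ?P"
    by (rule measure_surface_measure_fst_bounds) measurable
  also have "\<dots> = (LINT \<xi>|surface_measure. indicator ?P \<xi>)" by simp
  also have "\<dots> \<le> (LINT \<xi>|surface_measure. capped \<sigma> R c \<xi>)"
  proof (rule integral_mono_AE[OF _ integrable_capped])
    show "integrable surface_measure (indicat_real ?P)"
      by (rule integrable_real_indicator) (use P in simp, simp add: less_top[symmetric])
    show "AE \<xi> in surface_measure. indicator ?P \<xi> \<le> capped \<sigma> R c \<xi>"
      using AE_surface_measure_paraboloid
    proof eventually_elim
      case (elim \<xi>)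
      show ?case
      proof (cases "\<xi> \<in> ?P")
        case True
        then have "1 \<le> h_fun \<sigma> R \<xi>"
          unfolding h_fun_eq using member_le_sum[OF assms, of "\<lambda>l. indicat_real (freq_box \<sigma> R l) (fst \<xi>)"] by simp
        then show ?thesis using True elim by (simp add: capped_def cap_def)
      qed (simp add: capped_nonneg)
    qed
  qed
  finally show ?thesis .
qed

definition merge_scale :: "real \<Rightarrow> real" where
  "merge_scale \<sigma> = 3 powr (1 / (1 / 2 - \<sigma>))"

lemma merge_scale_ge_1: "\<sigma> < 1 / 2 \<Longrightarrow> 1 \<le> merge_scale \<sigma>"
  unfolding merge_scale_def by (rule ge_one_powr_ge_zero) auto

text \<open>
  A cap that meets the boxes of two different frequencies forces \<open>R\<^bsup>-\<sigma>\<^esup> \<le> 3 R\<^bsup>-1/2\<^esup>\<close>, that is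
  \<open>R \<le> merge_scale \<sigma>\<close>. So the support of \<open>capped\<close> has diameter \<open>O(1/R)\<close> for every \<open>R > 1\<close>.
\<close>

lemma capped_support_diameter:
  assumes "R > 1" "\<sigma> < 1 / 2" "capped \<sigma> R c \<xi> \<noteq> 0" "capped \<sigma> R c \<xi>' \<noteq> 0"
  shows "\<bar>fst \<xi> $ j - fst \<xi>' $ j\<bar> \<le> 2 * merge_scale \<sigma> / R"
proof -
  have cap: "\<xi> \<in> cap R c" "\<xi>' \<in> cap R c" using assms(3,4) by (auto simp: capped_def indicator_def split: if_splits)
  have "h_fun \<sigma> R \<xi> \<noteq> 0" "h_fun \<sigma> R \<xi>' \<noteq> 0" using assms(3,4) by (auto simp: capped_def)
  then obtain l l' where l: "l \<in> freqs \<sigma> R" "fst \<xi> \<in> freq_box \<sigma> R l"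
      and l': "l' \<in> freqs \<sigma> R" "fst \<xi>' \<in> freq_box \<sigma> R l'"
    by (elim h_fun_ne_zeroE)
  then have meet: "l \<in> freqs_meeting \<sigma> R c" "l' \<in> freqs_meeting \<sigma> R c"
    using cap by (auto simp: freqs_meeting_def cap_def)
  show ?thesis
  proof (cases "l = l'")
    case True
    then have "\<bar>fst \<xi> $ j - real_of_int (l $ j) * R powr (- \<sigma>)\<bar> < 1 / R"
      "\<bar>fst \<xi>' $ j - real_of_int (l $ j) * R powr (- \<sigma>)\<bar> < 1 / R"
      using l l' by (auto simp: mem_freq_box_iff)
    then have "\<bar>fst \<xi> $ j - fst \<xi>' $ j\<bar> \<le> 2 * 1 / R" by simp
    also have "\<dots> \<le> 2 * merge_scale \<sigma> / R"
      using merge_scale_ge_1[OF assms(2)] assms(1) by (intro divide_right_mono) auto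
    finally show ?thesis .
  next
    case False
    then obtain i where "l $ i \<noteq> l' $ i" by (auto simp: vec_eq_iff)
    then have "1 \<le> \<bar>real_of_int (l $ i) - real_of_int (l' $ i)\<bar>" by linarith
    then have "1 * R powr (- \<sigma>) \<le> \<bar>real_of_int (l $ i) - real_of_int (l' $ i)\<bar> * R powr (- \<sigma>)"
      by (intro mult_right_mono) auto
    also have "\<dots> \<le> 3 * R powr (- 1 / 2)" by (rule freqs_meeting_close[OF assms(1) meet])
    finally have "R powr (1 / 2) * R powr (- \<sigma>) \<le> R powr (1 / 2) * (3 * R powr (- 1 / 2))"
      by (intro mult_left_mono) auto
    also have "\<dots> = 3 * (R powr (1 / 2) * R powr (- 1 / 2))" by simp
    also have "\<dots> = 3" unfolding powr_add[symmetric] using assms(1) by simp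
    finally have "R powr (1 / 2 - \<sigma>) \<le> 3" by (simp add: powr_add[symmetric])
    then have "(R powr (1 / 2 - \<sigma>)) powr (1 / (1 / 2 - \<sigma>)) \<le> merge_scale \<sigma>"
      unfolding merge_scale_def using assms by (intro powr_mono2) auto
    then have "R \<le> merge_scale \<sigma>" using assms by (simp add: powr_powr)
    \<comment> \<open>For such R the claim is trivial: coordinates in [-1, 1] differ by at most
      2.\<close>
    then have "2 * 1 \<le> 2 * (merge_scale \<sigma> / R)" using assms by (intro mult_left_mono) auto
    moreover have "\<bar>fst \<xi> $ j\<bar> \<le> 1" "\<bar>fst \<xi>' $ j\<bar> \<le> 1" using cap by (auto simp: cap_def paraboloid_def)
    ultimately have "\<bar>fst \<xi> $ j - fst \<xi>' $ j\<bar> \<le> 2 * (merge_scale \<sigma> / R)" by linarith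
    then show ?thesis by simp
  qed
qed

text \<open>The support of a cap part has diameter O(1 / R), so for |x| up to a small multiple of R
  all phases stay close to that of one reference point; no integrality is involved. With L =
  \<open>merge_scale \<sigma>\<close> the deviation is at most R / (48 n^2 L) * 3 n^2 * 2 L / R =
  1/8.\<close>

lemma norm_extension_capped_ge:
  fixes x :: "'n::finite pt"
  assumes "R > 1" "\<sigma> < 1 / 2" "norm x \<le> R / (48 * (real CARD('n))\<^sup>2 * merge_scale \<sigma>)"
  shows "(LINT \<xi>|surface_measure. capped \<sigma> R c \<xi>) / 2 \<le> norm (extension (capped \<sigma> R c) x)"
proof -
  let ?n = "real CARD('n)" and ?L = "merge_scale \<sigma>"
  have L: "?L > 0" using merge_scale_ge_1[OF assms(2)] by linarith
  \<comment> \<open>A point of the support if there is one and an arbitrary point otherwise, so that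
    an empty support needs no separate case.\<close>
  obtain \<xi>0 where \<xi>0: "\<And>\<xi>. \<xi> \<in> paraboloid \<Longrightarrow> capped \<sigma> R c \<xi> \<noteq> 0 \<Longrightarrow> \<xi>0 \<in> paraboloid \<and> capped \<sigma> R c \<xi>0 \<noteq> 0"
    by blast
  show ?thesis
  proof (rule norm_extension_ge[where t = "x \<bullet> \<xi>0", OF integrable_capped capped_nonneg])
    fix \<xi> assume \<xi>: "\<xi> \<in> paraboloid" "capped \<sigma> R c \<xi> \<noteq> 0"
    note \<xi>0 = \<xi>0[OF this]
    have "norm (\<xi> - \<xi>0) \<le> 3 * ?n\<^sup>2 * (2 * ?L / R)"
      using lift_pt_dist_le[OF paraboloidD(1)[OF \<xi>(1)] paraboloidD(1)[OF conjunct1[OF \<xi>0]]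
          capped_support_diameter[OF assms(1,2) \<xi>(2) conjunct2[OF \<xi>0]]]
      unfolding paraboloidD(2)[OF \<xi>(1), symmetric] paraboloidD(2)[OF conjunct1[OF \<xi>0], symmetric] .
    then have "norm x * norm (\<xi> - \<xi>0) \<le> (R / (48 * ?n\<^sup>2 * ?L)) * (3 * ?n\<^sup>2 * (2 * ?L / R))"
      using assms L by (intro mult_mono) auto
    also have "\<dots> = 1 / 8" using assms L by (simp add: field_simps)
    finally have "\<bar>x \<bullet> (\<xi> - \<xi>0)\<bar> \<le> 1 / 8"
      using Cauchy_Schwarz_ineq2[of x "\<xi> - \<xi>0"] by linarith
    then show "\<exists>k\<in>\<int>. \<bar>x \<bullet> \<xi> - x \<bullet> \<xi>0 - k\<bar> \<le> 1 / 8"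
      by (intro bexI[of _ 0]) (auto simp: inner_diff_right)
  qed
qed

section \<open>Active and heavy caps\<close>

definition active_caps :: "real \<Rightarrow> real \<Rightarrow> (real ^ 'n::finite) set \<Rightarrow> (real ^ 'n) set" where
  "active_caps \<sigma> R \<Theta> = {c \<in> \<Theta>. freqs_meeting \<sigma> R c \<noteq> {}}"

text \<open>The threshold is half of the average share when mass R^(-n), guaranteed for each box
  within the unit cube, is split among 4^n caps.\<close>

definition heavy_caps :: "real \<Rightarrow> real \<Rightarrow> (real ^ 'n::finite) set \<Rightarrow> (real ^ 'n) set" where
  "heavy_caps \<sigma> R \<Theta> = {c \<in> \<Theta>. (1 / R) ^ CARD('n) / (2 * 4 ^ CARD('n)) \<le> (LINT \<xi>|surface_measure. capped \<sigma> R c \<xi>)}"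

lemma active_caps_bound:
  fixes \<Theta> :: "(real ^ 'n::finite) set"
  assumes "disjoint_family_on (cap_cube R) \<Theta>" "R > 1" "\<sigma> > 0"
  shows "finite (active_caps \<sigma> R \<Theta>)" "real (card (active_caps \<sigma> R \<Theta>)) \<le> 4 ^ CARD('n) * R powr (real CARD('n) * \<sigma>)"
proof -
  note cm = caps_meeting_bound[OF assms(1,2)]
  have eq: "active_caps \<sigma> R \<Theta> = (\<Union>l\<in>freqs \<sigma> R. caps_meeting \<sigma> R \<Theta> l)"
    by (auto simp: active_caps_def freqs_meeting_def caps_meeting_def)
  show "finite (active_caps \<sigma> R \<Theta>)" unfolding eq using cm by simp
  have "card (active_caps \<sigma> R \<Theta>) \<le> (\<Sum>l\<in>freqs \<sigma> R. card (caps_meeting \<sigma> R \<Theta> l))"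
    unfolding eq by (rule card_UN_le) simp
  then have "real (card (active_caps \<sigma> R \<Theta>)) \<le> (\<Sum>l\<in>freqs \<sigma> R. real (card (caps_meeting \<sigma> R \<Theta> l)))"
    by (metis of_nat_le_iff of_nat_sum)
  also have "\<dots> \<le> real (card (freqs \<sigma> R :: (int ^ 'n) set)) * 4 ^ CARD('n)"
    using cm by (intro sum_bounded_above)
  also have "\<dots> \<le> R powr (real CARD('n) * \<sigma>) * 4 ^ CARD('n)"
    using freqs_card_bounds(1)[OF assms(2,3)] by (intro mult_right_mono) auto
  finally show "real (card (active_caps \<sigma> R \<Theta>)) \<le> 4 ^ CARD('n) * R powr (real CARD('n) * \<sigma>)"
    by (simp add: mult.commute)
qed

lemma capped_inactive:
  assumes "c \<in> \<Theta>" "c \<notin> active_caps \<sigma> R \<Theta>"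
  shows "capped \<sigma> R c = (\<lambda>_. 0)"
  using assms capped_le[of \<sigma> R c] capped_nonneg[of \<sigma> R c] by (intro ext antisym) (auto simp: active_caps_def)

text \<open>Pigeonhole: at most 4^n caps cover the part of the box in the unit cube. If each of them
  carried at most the threshold, the total would be at most half of R^(-n), less than the mass of
  the box.\<close>

lemma freq_meets_heavy_cap:
  fixes \<Theta> :: "(real ^ 'n::finite) set"
  assumes "disjoint_family_on (cap_cube R) \<Theta>" "unit_cube \<subseteq> (\<Union>c\<in>\<Theta>. cap_cube R c)" "R > 1"
    and l: "l \<in> freqs \<sigma> R"
  shows "\<exists>c\<in>heavy_caps \<sigma> R \<Theta>. l \<in> freqs_meeting \<sigma> R c"
proof -
  define \<epsilon> where "\<epsilon> = (1 / R) ^ CARD('n) / (2 * 4 ^ CARD('n))"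
  have \<epsilon>: "\<epsilon> > 0" using assms by (simp add: \<epsilon>_def)
  note cm = caps_meeting_bound[OF assms(1,3), of \<sigma> l]
  let ?m = "\<lambda>c. measure lborel (cap_cube R c \<inter> freq_box \<sigma> R l \<inter> unit_cube)"
  have "\<exists>c\<in>caps_meeting \<sigma> R \<Theta> l. \<epsilon> \<le> ?m c"
  proof (rule ccontr)
    assume "\<not> ?thesis"
    then have less: "?m c \<le> \<epsilon>" if "c \<in> caps_meeting \<sigma> R \<Theta> l" for c using that by force
    have fm: "cap_cube R c \<inter> freq_box \<sigma> R l \<inter> unit_cube \<in> fmeasurable lborel" for c
      by (rule fmeasurableI2[OF unit_cube_fmeasurable]) auto
    have sub: "freq_box \<sigma> R l \<inter> unit_cube \<subseteq> (\<Union>c\<in>caps_meeting \<sigma> R \<Theta> l. cap_cube R c \<inter> freq_box \<sigma> R l \<inter> unit_cube)"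
      using assms(2) by (fastforce simp: caps_meeting_def)
    have "(1 / R) ^ CARD('n) \<le> measure lborel (freq_box \<sigma> R l \<inter> unit_cube)"
      by (rule measure_freq_box_bounds(2)[OF assms(3) l])
    also have "\<dots> \<le> measure lborel (\<Union>c\<in>caps_meeting \<sigma> R \<Theta> l. cap_cube R c \<inter> freq_box \<sigma> R l \<inter> unit_cube)"
      by (rule measure_mono_fmeasurable[OF sub]) (measurable, use cm fm in \<open>blast intro: fmeasurable.finite_UN\<close>)
    also have "\<dots> \<le> (\<Sum>c\<in>caps_meeting \<sigma> R \<Theta> l. ?m c)"
      using cm by (intro measure_UNION_le) auto
    also have "\<dots> \<le> real (card (caps_meeting \<sigma> R \<Theta> l)) * \<epsilon>" using less by (rule sum_bounded_above)
    also have "\<dots> \<le> 4 ^ CARD('n) * \<epsilon>" using cm \<epsilon> by (intro mult_right_mono) auto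
    also have "\<dots> = (1 / R) ^ CARD('n) / 2" by (simp add: \<epsilon>_def)
    finally show False using assms(3) by simp
  qed
  then obtain c where c: "c \<in> caps_meeting \<sigma> R \<Theta> l" "\<epsilon> \<le> ?m c" by blast
  have "c \<in> heavy_caps \<sigma> R \<Theta>"
    using c integral_capped_ge[OF l, of c] by (auto simp: heavy_caps_def caps_meeting_def \<epsilon>_def)
  moreover have "l \<in> freqs_meeting \<sigma> R c" using c(1) l by (simp add: caps_meeting_def freqs_meeting_def)
  ultimately show ?thesis by blast
qed

text \<open>Every frequency is met by a heavy cap and every cap meets at most 7^n frequencies. With
  the 2^n lost in counting frequencies this gives 14^n.\<close>

lemma heavy_caps_bound:
  fixes \<Theta> :: "(real ^ 'n::finite) set"
  assumes "disjoint_family_on (cap_cube R) \<Theta>" "unit_cube \<subseteq> (\<Union>c\<in>\<Theta>. cap_cube R c)" "R > 1" "\<sigma> > 0" "\<sigma> < 1 / 2"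
    and "finite \<Theta>"
  shows "R powr (real CARD('n) * \<sigma>) \<le> 14 ^ CARD('n) * real (card (heavy_caps \<sigma> R \<Theta>))"
proof -
  have fin: "finite (heavy_caps \<sigma> R \<Theta>)" using assms(6) by (simp add: heavy_caps_def)
  note fb = freqs_meeting_bound[OF assms(3,5)]
  have "freqs \<sigma> R \<subseteq> (\<Union>c\<in>heavy_caps \<sigma> R \<Theta>. freqs_meeting \<sigma> R c)"
    using freq_meets_heavy_cap[OF assms(1-3)] by blast
  then have "card (freqs \<sigma> R :: (int ^ 'n) set) \<le> card (\<Union>c\<in>heavy_caps \<sigma> R \<Theta>. freqs_meeting \<sigma> R c)"
    using fin fb by (intro card_mono) auto
  also have "\<dots> \<le> (\<Sum>c\<in>heavy_caps \<sigma> R \<Theta>. card (freqs_meeting \<sigma> R c))" using fin by (rule card_UN_le)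
  finally have "real (card (freqs \<sigma> R :: (int ^ 'n) set)) \<le> (\<Sum>c\<in>heavy_caps \<sigma> R \<Theta>. real (card (freqs_meeting \<sigma> R c)))"
    by (metis of_nat_le_iff of_nat_sum)
  also have "\<dots> \<le> real (card (heavy_caps \<sigma> R \<Theta>)) * 7 ^ CARD('n)"
    using fb by (intro sum_bounded_above)
  finally have "2 ^ CARD('n) * real (card (freqs \<sigma> R :: (int ^ 'n) set)) \<le> 2 ^ CARD('n) * (real (card (heavy_caps \<sigma> R \<Theta>)) * 7 ^ CARD('n))"
    by (rule mult_left_mono) simp
  also have "\<dots> = 14 ^ CARD('n) * real (card (heavy_caps \<sigma> R \<Theta>))"
    using power_mult_distrib[of 2 "7::real" "CARD('n)"] by simp
  finally show ?thesis using freqs_card_bounds(2)[OF assms(3,4), where 'n = 'n] by linarith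
qed

section \<open>Wave packets, weights and the decoupling inequality\<close>

lemma wave_packet_systemD:
  assumes "wave_packet_system A D R \<Theta> U V \<eta>"
  shows "disjoint_family_on (cap_cube R) \<Theta>" "unit_cube \<subseteq> (\<Union>c\<in>\<Theta>. cap_cube R c)"
    and "c \<in> \<Theta> \<Longrightarrow> disjoint_family_on (\<lambda>\<tau>. (+) \<tau> ` tube A R (U c)) (V c)"
    and "c \<in> \<Theta> \<Longrightarrow> (\<Union>\<tau>\<in>V c. (+) \<tau> ` tube A R (U c)) = UNIV"
    and "c \<in> \<Theta> \<Longrightarrow> ((\<lambda>\<tau>. \<eta> c \<tau> x) has_sum 1) (V c)"
    and "c \<in> \<Theta> \<Longrightarrow> \<tau> \<in> V c \<Longrightarrow> x \<in> (+) \<tau> ` tube A R (U c) \<Longrightarrow> 1 / A \<le> norm (\<eta> c \<tau> x)"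
    and "c \<in> \<Theta> \<Longrightarrow> cap R c \<noteq> {}"
  using assms unfolding wave_packet_system_def unit_cube_def by blast+

text \<open>Caps are nonempty, so each cube contains a point of the unit cube, and the packing bound
  applies around 0 with \<rho> = 1.\<close>

lemma finite_caps:
  fixes \<Theta> :: "(real ^ 'n::finite) set"
  assumes "wave_packet_system A D R \<Theta> U V \<eta>" "R > 0"
  shows "finite \<Theta>"
proof -
  have "\<exists>\<xi>\<in>cap_cube R c. \<forall>j. \<bar>\<xi> $ j - 0 $ j\<bar> \<le> 1" if "c \<in> \<Theta>" for c
    using wave_packet_systemD(7)[OF assms(1) that] by (auto simp: cap_def paraboloid_def)
  then show ?thesis
    using card_cap_cubes_le[OF wave_packet_systemD(1)[OF assms(1)] assms(2), of 1 0] by simp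
qed

lemma extension_zero: "extension (\<lambda>_. 0) = (\<lambda>_. 0)"
  by (simp add: extension_def fun_eq_iff)

text \<open>The cutoffs of one cap sum to 1 at every point, so the packets recombine exactly. Norms
  of cap parts become independent of the chosen tubes and cutoffs.\<close>

lemma cap_part_eq_extension:
  assumes "wave_packet_system A D R \<Theta> U V \<eta>" "c \<in> \<Theta>"
  shows "cap_part (h_fun \<sigma> R) R V \<eta> c = extension (capped \<sigma> R c)"
proof
  fix x
  have "((\<lambda>\<tau>. \<eta> c \<tau> x * extension (capped \<sigma> R c) x) has_sum 1 * extension (capped \<sigma> R c) x) (V c)"
    by (intro has_sum_cmult_left wave_packet_systemD(5)[OF assms])
  then show "cap_part (h_fun \<sigma> R) R V \<eta> c x = extension (capped \<sigma> R c) x"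
    unfolding cap_part_def wave_packet_def capped_def by (simp add: infsumI)
qed

lemma packets_hit_bound:
  fixes \<Theta> :: "(real ^ 'n::finite) set"
  assumes W: "wave_packet_system A D R \<Theta> U V \<eta>" and R: "R > 1" and \<sigma>: "\<sigma> > 0"
  shows "finite (packets_hit (h_fun \<sigma> R) A R \<Theta> U V \<eta> x)"
    and "card (packets_hit (h_fun \<sigma> R) A R \<Theta> U V \<eta> x) \<le> card (active_caps \<sigma> R \<Theta>)"
proof -
  let ?H = "packets_hit (h_fun \<sigma> R) A R \<Theta> U V \<eta> x"
  note fin = active_caps_bound(1)[OF wave_packet_systemD(1)[OF W] R \<sigma>]
  \<comment> \<open>The tubes of one cap are disjoint, so the cap determines which of its packets is
    hit.\<close>
  have inj: "inj_on fst ?H"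
  proof (rule inj_onI)
    fix a b assume ab: "a \<in> ?H" "b \<in> ?H" "fst a = fst b"
    obtain c \<tau> \<tau>' where eq: "a = (c, \<tau>)" "b = (c, \<tau>')" using ab(3) by (metis prod.collapse)
    then show "a = b"
      using ab wave_packet_systemD(3)[OF W, of c] unfolding packets_hit_def disjoint_family_on_def by blast
  qed
  have sub: "fst ` ?H \<subseteq> active_caps \<sigma> R \<Theta>"
  proof (rule image_subsetI)
    fix a assume "a \<in> ?H"
    then obtain c \<tau> where a: "a = (c, \<tau>)" "c \<in> \<Theta>" "wave_packet (h_fun \<sigma> R) R \<eta> c \<tau> \<noteq> (\<lambda>_. 0)"
      by (auto simp: packets_hit_def)
    have "wave_packet (h_fun \<sigma> R) R \<eta> c \<tau> = (\<lambda>_. 0)" if "c \<notin> active_caps \<sigma> R \<Theta>"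
      using capped_inactive[OF a(2) that]
      by (simp add: wave_packet_def[abs_def] capped_def extension_zero)
    then show "fst a \<in> active_caps \<sigma> R \<Theta>" using a by auto
  qed
  show "finite ?H" using finite_imageD[OF finite_subset[OF sub fin] inj] .
  show "card ?H \<le> card (active_caps \<sigma> R \<Theta>)" using card_inj_on_le[OF inj sub fin] .
qed

text \<open>Only nonzero packets count, so lying in a tube is not enough. At the origin the
  extension of a heavy cap is nonzero, and the cutoff of the tube containing the origin has modulus
  at least 1 / A there.\<close>

lemma heavy_caps_hit_origin:
  fixes \<Theta> :: "(real ^ 'n::finite) set"
  assumes W: "wave_packet_system A D R \<Theta> U V \<eta>" and R: "R > 1" and \<sigma>: "\<sigma> > 0" "\<sigma> < 1 / 2" and A: "A > 0"
  shows "heavy_caps \<sigma> R \<Theta> \<subseteq> fst ` packets_hit (h_fun \<sigma> R) A R \<Theta> U V \<eta> 0"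
proof
  fix c assume c: "c \<in> heavy_caps \<sigma> R \<Theta>"
  then have c\<Theta>: "c \<in> \<Theta>" by (simp add: heavy_caps_def)
  obtain \<tau> where \<tau>: "\<tau> \<in> V c" "0 \<in> (+) \<tau> ` tube A R (U c)"
    using wave_packet_systemD(4)[OF W c\<Theta>] by blast
  have "0 < (1 / R) ^ CARD('n) / (2 * 4 ^ CARD('n))" using R by simp
  also have "\<dots> \<le> (LINT \<xi>|surface_measure. capped \<sigma> R c \<xi>)" using c by (simp add: heavy_caps_def)
  finally have "0 < (LINT \<xi>|surface_measure. capped \<sigma> R c \<xi>) / 2" by simp
  also have "\<dots> \<le> norm (extension (capped \<sigma> R c) 0)"
    using merge_scale_ge_1[OF \<sigma>(2)] R by (intro norm_extension_capped_ge \<sigma>) auto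
  finally have "extension (capped \<sigma> R c) 0 \<noteq> 0" by simp
  moreover have "0 < norm (\<eta> c \<tau> 0)"
    using wave_packet_systemD(6)[OF W c\<Theta> \<tau>] A by (meson divide_pos_pos less_le_trans zero_less_one)
  ultimately have "wave_packet (h_fun \<sigma> R) R \<eta> c \<tau> 0 \<noteq> 0"
    by (simp add: wave_packet_def capped_def)
  then have "(c, \<tau>) \<in> packets_hit (h_fun \<sigma> R) A R \<Theta> U V \<eta> 0"
    using c\<Theta> \<tau> by (auto simp: packets_hit_def)
  then show "c \<in> fst ` packets_hit (h_fun \<sigma> R) A R \<Theta> U V \<eta> 0" by force
qed

lemma zero_in_X_set: "R > 0 \<Longrightarrow> 0 \<in> X_set \<sigma> R"
proof -
  assume "R > 0"
  have "lattice_pt \<sigma> R (0, 0) = 0" by (simp add: lattice_pt_def zero_prod_def vec_eq_iff)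
  then have "0 \<in> lattice \<sigma> R" unfolding lattice_eq_range by (metis rangeI)
  then show ?thesis using \<open>R > 0\<close> unfolding X_set_def by (intro UN_I[of 0]) auto
qed

lemma hits_at_mostD: "hits_at_most H X m \<Longrightarrow> x \<in> X \<Longrightarrow> finite (H x) \<and> card (H x) \<le> m"
  by (simp add: hits_at_most_def)

text \<open>The number of active caps is an admissible bound, hence at least M. Since M is itself
  admissible and the origin belongs to X, M is at least the number of heavy caps. The constant 14^n
  from the lower bound also covers the 4^n from the upper one.\<close>

lemma least_hits_bounds:
  fixes \<Theta> :: "(real ^ 'n::finite) set" and \<sigma> R A :: real
  assumes W: "wave_packet_system A D R \<Theta> U V \<eta>" and R: "R > 1" and \<sigma>: "\<sigma> > 0" "\<sigma> < 1 / 2" and A: "A > 0"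
  defines "hit \<equiv> hits_at_most (packets_hit (h_fun \<sigma> R) A R \<Theta> U V \<eta>) (X_set \<sigma> R)"
  shows "hit (LEAST m. hit m)"
    and "comparable (14 ^ CARD('n)) (real (LEAST m. hit m)) (R powr (real CARD('n) * \<sigma>))"
proof -
  let ?H = "packets_hit (h_fun \<sigma> R) A R \<Theta> U V \<eta>" and ?M = "LEAST m. hit m"
  have act: "hit (card (active_caps \<sigma> R \<Theta>))"
    unfolding hit_def hits_at_most_def using packets_hit_bound[OF W R \<sigma>(1)] by blast
  then show M: "hit ?M" by (rule LeastI)
  note D = wave_packet_systemD(1,2)[OF W]
  have "real ?M \<le> real (card (active_caps \<sigma> R \<Theta>))" using Least_le[of hit, OF act] by simp
  also have "\<dots> \<le> 4 ^ CARD('n) * R powr (real CARD('n) * \<sigma>)" by (rule active_caps_bound(2)[OF D(1) R \<sigma>(1)])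
  also have "\<dots> \<le> 14 ^ CARD('n) * R powr (real CARD('n) * \<sigma>)" by (intro mult_right_mono power_mono) auto
  finally have upper: "real ?M \<le> 14 ^ CARD('n) * R powr (real CARD('n) * \<sigma>)" .
  have H0: "finite (?H 0)" "card (?H 0) \<le> ?M"
    using hits_at_mostD[OF M[unfolded hit_def] zero_in_X_set[of R \<sigma>]] R unfolding hit_def by auto
  have "card (heavy_caps \<sigma> R \<Theta>) \<le> card (fst ` ?H 0)"
    using heavy_caps_hit_origin[OF W R \<sigma> A] H0 by (intro card_mono) auto
  also have "\<dots> \<le> card (?H 0)" using H0 by (intro card_image_le)
  finally have "real (card (heavy_caps \<sigma> R \<Theta>)) \<le> real ?M" using H0(2) by linarith
  then have "14 ^ CARD('n) * real (card (heavy_caps \<sigma> R \<Theta>)) \<le> 14 ^ CARD('n) * real ?M"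
    by (intro mult_left_mono) auto
  then have "R powr (real CARD('n) * \<sigma>) \<le> 14 ^ CARD('n) * real ?M"
    using heavy_caps_bound[OF D R \<sigma> finite_caps[OF W]] R by linarith
  with upper show "comparable (14 ^ CARD('n)) (real ?M) (R powr (real CARD('n) * \<sigma>))"
    by (simp add: comparable_def)
qed

section \<open>Mass of the weight\<close>

lemma ex_dyadic_scale:
  fixes y :: real
  assumes "1 \<le> y"
  shows "\<exists>k. 2 ^ k \<le> y \<and> y < 2 ^ Suc k"
proof -
  obtain m where "y < 2 ^ m" using real_arch_pow[of 2 y] by auto
  then have ex: "\<exists>m. y < 2 ^ m" by blast
  define m where "m = (LEAST m. y < 2 ^ m)"
  have m: "y < 2 ^ m" unfolding m_def using ex by (rule LeastI_ex)
  then have "m \<noteq> 0" using assms by (cases m) auto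
  then obtain k where k: "m = Suc k" by (cases m) auto
  then have "\<not> y < 2 ^ k" using not_less_Least[of k "\<lambda>m. y < 2 ^ m"] unfolding m_def by simp
  then show ?thesis using m k by (intro exI[of _ k]) auto
qed

lemma emeasure_ball_scale:
  assumes "r \<ge> 0"
  shows "emeasure lborel (ball (0 :: 'a::euclidean_space) r) = ennreal (r ^ DIM('a) * measure lborel (ball (0 :: 'a) 1))"
  using content_ball_conv_unit_ball[OF assms, of "0 :: 'a"] emeasure_eq_measure2[OF ball_fmeasurable, of "0 :: 'a" r] by simp

lemma ennreal_le_suminf: "f k \<le> (\<Sum>k. f k)" for f :: "nat \<Rightarrow> ennreal"
  using sum_le_suminf[OF summableI, of "{k}" f] by simp

text \<open>Dyadic decomposition with decay exponent d + 1, one more than the dimension. Where 1 +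
  |x| / R is about 2^k, the weight is at most K 2^(-k (d + 1)), and a ball of volume v (2^(k + 1)
  R)^d covers the region. The products K v (2 R)^d 2^(-k) sum geometrically, which gives the last
  factor 2.\<close>

lemma ball_weight_integral_le:
  fixes w :: "'n::finite pt \<Rightarrow> real"
  assumes w: "ball_weight A D R w" and R: "R > 0"
  shows "(\<integral>\<^sup>+x. ennreal (w x) \<partial>lborel) \<le>
    ennreal (D (CARD('n) + 2) * measure lborel (ball (0 :: 'n pt) 1) * (2 * R) ^ (CARD('n) + 1) * 2)"
proof -
  define d where "d = CARD('n) + 1"
  define K where "K = D (Suc d)"
  define v where "v = measure lborel (ball (0 :: 'n pt) 1)"
  have wD: "0 \<le> w x" "w x \<le> K / (1 + norm x / R) ^ Suc d" for x
    using w unfolding ball_weight_def K_def by blast+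
  have K: "0 \<le> K" using order_trans[OF wD(1) wD(2)[of 0]] by simp
  have v: "v \<ge> 0" by (simp add: v_def)
  let ?f = "\<lambda>k x :: 'n pt. ennreal (K / (2 ^ k) ^ Suc d) * indicator (ball 0 (2 ^ Suc k * R)) x"
  have point: "ennreal (w x) \<le> (\<Sum>k. ?f k x)" for x
  proof -
    obtain k where k: "2 ^ k \<le> 1 + norm x / R" "1 + norm x / R < 2 ^ Suc k"
      using ex_dyadic_scale[of "1 + norm x / R"] R by auto
    have "w x \<le> K / (2 ^ k) ^ Suc d"
      using wD(2)[of x] K k(1) R
      by (elim order_trans) (intro divide_left_mono power_mono mult_pos_pos zero_less_power, auto intro: add_pos_nonneg)
    moreover have "norm x / R < 2 ^ Suc k" using k(2) by simp
    then have "x \<in> ball 0 (2 ^ Suc k * R)" using R by (simp add: divide_less_eq)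
    ultimately have "ennreal (w x) \<le> ?f k x" by (simp add: ennreal_leI)
    also have "\<dots> \<le> (\<Sum>k. ?f k x)" by (rule ennreal_le_suminf)
    finally show ?thesis .
  qed
  have "(\<integral>\<^sup>+x. ennreal (w x) \<partial>lborel) \<le> (\<integral>\<^sup>+x. (\<Sum>k. ?f k x) \<partial>lborel)"
    using point by (intro nn_integral_mono) auto
  also have "\<dots> = (\<Sum>k. \<integral>\<^sup>+x. ?f k x \<partial>lborel)"
    by (intro nn_integral_suminf) (auto intro!: borel_measurable_times_ennreal borel_measurable_indicator)
  also have "\<dots> = (\<Sum>k. ennreal (K * v * (2 * R) ^ d * (1 / 2) ^ k))"
  proof (rule suminf_cong)
    fix k
    have "(\<integral>\<^sup>+x. ?f k x \<partial>lborel) = ennreal (K / (2 ^ k) ^ Suc d) * ennreal ((2 ^ Suc k * R) ^ d * v)"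
      using R by (subst nn_integral_cmult_indicator) (simp_all add: emeasure_ball_scale d_def v_def del: power_Suc)
    also have "\<dots> = ennreal (K / (2 ^ k) ^ Suc d * ((2 ^ Suc k * R) ^ d * v))"
      using K by (intro ennreal_mult'[symmetric]) simp
    also have "K / (2 ^ k) ^ Suc d * ((2 ^ Suc k * R) ^ d * v) = K * v * (2 * R) ^ d * (1 / 2) ^ k"
      by (simp add: power_mult_distrib field_simps)
    finally show "(\<integral>\<^sup>+x. ?f k x \<partial>lborel) = ennreal (K * v * (2 * R) ^ d * (1 / 2) ^ k)" .
  qed
  also have "\<dots> = ennreal (\<Sum>k. K * v * (2 * R) ^ d * (1 / 2) ^ k)"
    using K v R by (intro suminf_ennreal2 summable_mult summable_geometric) auto
  also have "(\<Sum>k. K * v * (2 * R) ^ d * (1 / 2) ^ k) = K * v * (2 * R) ^ d * 2"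
    by (subst suminf_mult) (auto simp: suminf_geometric intro!: summable_geometric)
  finally show ?thesis by (simp add: K_def v_def d_def)
qed

lemma ball_weight_measure:
  fixes w :: "'n::finite pt \<Rightarrow> real"
  assumes w: "ball_weight A D R w" and R: "R > 0" and A: "A > 0"
  defines "N \<equiv> density lborel (\<lambda>x. ennreal (w x))"
  shows "finite_measure N"
    and "measure N (space N) \<le> D (CARD('n) + 2) * measure lborel (ball (0 :: 'n pt) 1) * 2 ^ (CARD('n) + 2) * R ^ (CARD('n) + 1)"
    and "0 \<le> r \<Longrightarrow> r \<le> R \<Longrightarrow> r ^ (CARD('n) + 1) * measure lborel (ball (0 :: 'n pt) 1) / A \<le> measure N (ball 0 r)"
proof -
  have [measurable]: "w \<in> borel_measurable borel" and wD: "\<And>x. 0 \<le> w x" "\<And>x. x \<in> ball 0 R \<Longrightarrow> 1 / A \<le> w x"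
    using w unfolding ball_weight_def by blast+
  let ?K = "D (CARD('n) + 2) * measure lborel (ball (0 :: 'n pt) 1) * (2 * R) ^ (CARD('n) + 1) * 2"
  \<comment> \<open>The decay bound at the origin forces this constant to be nonnegative.\<close>
  have D0: "0 \<le> D (CARD('n) + 2)"
    using w order_trans[of 0 "w 0" "D (CARD('n) + 2)"] unfolding ball_weight_def
    by (metis add.right_neutral div_by_1 divide_eq_0_iff norm_zero power_one)
  have K0: "0 \<le> ?K" using D0 R by auto
  have sp: "emeasure N (space N) \<le> ennreal ?K"
    using ball_weight_integral_le[OF w R] by (simp add: N_def emeasure_density)
  then show fin: "finite_measure N"
    by (intro finite_measureI) (metis ennreal_less_top infinity_ennreal_def leD)
  interpret finite_measure N by (rule fin)
  show "measure N (space N) \<le> D (CARD('n) + 2) * measure lborel (ball (0 :: 'n pt) 1) * 2 ^ (CARD('n) + 2) * R ^ (CARD('n) + 1)"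
    using sp K0 unfolding emeasure_eq_measure by (simp add: power_mult_distrib mult_ac)
  assume r: "0 \<le> r" "r \<le> R"
  have "ennreal (1 / A) * emeasure lborel (ball (0 :: 'n pt) r) = (\<integral>\<^sup>+x. ennreal (1 / A) * indicator (ball (0 :: 'n pt) r) x \<partial>lborel)"
    by (rule nn_integral_cmult_indicator[symmetric]) simp
  also have "\<dots> \<le> (\<integral>\<^sup>+x. ennreal (w x) * indicator (ball 0 r) x \<partial>lborel)"
    using wD(2) r by (intro nn_integral_mono) (auto simp: indicator_def intro!: ennreal_leI)
  also have "\<dots> = ennreal (measure N (ball 0 r))"
    unfolding emeasure_eq_measure[symmetric] by (simp add: N_def emeasure_density)
  finally show "r ^ (CARD('n) + 1) * measure lborel (ball (0 :: 'n pt) 1) / A \<le> measure N (ball 0 r)"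
    using r A by (simp add: emeasure_ball_scale ennreal_mult'[symmetric])
qed

lemma Lp_norm_powr:
  assumes "p > 0"
  shows "Lp_norm p N f powr p = (LINT x|N. norm (f x) powr p)"
proof -
  have "0 \<le> (LINT x|N. norm (f x) powr p)" by (intro Bochner_Integration.integral_nonneg) auto
  then show ?thesis using assms by (simp add: Lp_norm_def powr_powr)
qed

text \<open>The exponent collects about R^(n \<sigma>) contributing caps, the size R^(-n) of each
  part raised to the power p, and the mass R^(n + 1) of the weight.\<close>

lemma sum_cap_norms_comparable:
  fixes D :: "nat \<Rightarrow> real"
  assumes \<sigma>: "0 < \<sigma>" "\<sigma> < 1 / 2" and A: "A > 0" and p: "p > 0"
  shows "\<exists>C>0. \<forall>R>1. \<forall>(\<Theta> :: (real ^ 'n::finite) set) U V \<eta> w.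
    wave_packet_system A D R \<Theta> U V \<eta> \<and> ball_weight A D R w \<longrightarrow>
    comparable C (\<Sum>c\<in>\<Theta>. Lp_norm p (density lborel (\<lambda>x. ennreal (w x))) (cap_part (h_fun \<sigma> R) R V \<eta> c) powr p)
      (R powr (real CARD('n) * \<sigma> - real CARD('n) * p + (real CARD('n) + 1)))"
proof -
  let ?n = "real CARD('n)"
  define v where "v = measure lborel (ball (0 :: 'n pt) 1)"
  have v: "v > 0" unfolding v_def by (rule content_ball_pos) simp
  \<comment> \<open>Up to radius \<open>\<kappa> * R\<close> there is no cancellation in
    \<open>norm_extension_capped_ge\<close>; \<open>\<kappa> \<le> 1\<close> keeps this ball inside
    B_R, where the weight is at least 1 / A.\<close>
  define \<kappa> where "\<kappa> = 1 / (48 * ?n\<^sup>2 * merge_scale \<sigma>)"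
  have "1 \<le> ?n\<^sup>2" by (simp add: Suc_leI)
  then have "1 \<le> 48 * ?n\<^sup>2" by linarith
  then have "1 * 1 \<le> (48 * ?n\<^sup>2) * merge_scale \<sigma>"
    using merge_scale_ge_1[OF \<sigma>(2)] by (intro mult_mono) auto
  then have \<kappa>: "0 < \<kappa>" "\<kappa> \<le> 1" using merge_scale_ge_1[OF \<sigma>(2)] by (auto simp: \<kappa>_def)
  \<comment> \<open>Constants are fixed before a weight is given, so the sign of \<open>D\<close> is
    not yet known; the absolute value makes \<open>W\<close> nonnegative in any case.\<close>
  define W where "W = \<bar>D (CARD('n) + 2)\<bar> * v * 2 ^ (CARD('n) + 2)"
  have W: "W \<ge> 0" using v by (simp add: W_def)
  define B where "B = 7 ^ CARD('n) * ((1 + 2 * ?n) * 2 ^ CARD('n))"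
  \<comment> \<open>Half of the threshold for heavy caps, the other half being lost in
    \<open>norm_extension_capped_ge\<close>.\<close>
  define b where "b = 1 / (4 * 4 ^ CARD('n) :: real)"
  have Bb: "B > 0" "b > 0" by (auto simp: B_def b_def add_pos_nonneg)
  define C1 where "C1 = 4 ^ CARD('n) * (B powr p * W)"
  define c2 where "c2 = b powr p * (\<kappa> ^ (CARD('n) + 1) * v / A) / 14 ^ CARD('n)"
  have c2: "c2 > 0" using Bb \<kappa> v A by (simp add: c2_def)
  have "comparable (max C1 (1 / c2))
      (\<Sum>c\<in>\<Theta>. Lp_norm p (density lborel (\<lambda>x. ennreal (w x))) (cap_part (h_fun \<sigma> R) R V \<eta> c) powr p)
      (R powr (?n * \<sigma> - ?n * p + (?n + 1)))"
    if R: "R > 1" and sys: "wave_packet_system A D R \<Theta> U V \<eta>" and w: "ball_weight A D R w"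
    for R \<Theta> U V \<eta> and w :: "'n pt \<Rightarrow> real"
  proof -
    define N where "N = density lborel (\<lambda>x. ennreal (w x))"
    have R0: "R > 0" using R by simp
    note Nw = ball_weight_measure[OF w R0 A, folded N_def v_def]
    interpret finite_measure N by (rule Nw(1))
    let ?q = "R powr (- ?n)" and ?S = "R powr (?n + 1)"
    have q: "(1 / R) ^ CARD('n) = ?q" "(2 / R) ^ CARD('n) = 2 ^ CARD('n) * ?q" "R ^ (CARD('n) + 1) = ?S"
      using R by (simp_all add: powr_minus_divide powr_realpow power_divide powr_add)
    define I where "I c = (LINT x|N. norm (extension (capped \<sigma> R c) x) powr p)" for c :: "real ^ 'n"
    have I0: "0 \<le> I c" for c unfolding I_def by (intro Bochner_Integration.integral_nonneg) auto
    have fin: "finite \<Theta>" by (rule finite_caps[OF sys R0])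
    have sum_eq: "(\<Sum>c\<in>\<Theta>. Lp_norm p N (cap_part (h_fun \<sigma> R) R V \<eta> c) powr p) = (\<Sum>c\<in>\<Theta>. I c)"
      by (intro sum.cong refl) (simp add: I_def Lp_norm_powr[OF p] cap_part_eq_extension[OF sys])
    have meas: "extension (capped \<sigma> R c) \<in> borel_measurable N" for c :: "real ^ 'n"
      using extension_measurable[OF capped_measurable, of \<sigma> R c] by (simp add: N_def)
    have sup: "norm (extension (capped \<sigma> R c) x) \<le> B * ?q" for c :: "real ^ 'n" and x
    proof -
      have "norm (extension (capped \<sigma> R c) x) \<le> 7 ^ CARD('n) * ((1 + 2 * ?n) * (2 / R) ^ CARD('n))"
        using order_trans[OF norm_extension_le[OF capped_nonneg] integral_capped_le[OF R \<sigma>(2)]] .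
      then show ?thesis unfolding q B_def by (simp add: mult_ac)
    qed
    have Iupper: "I c \<le> B powr p * W * (?q powr p * ?S)" for c
    proof -
      have "I c \<le> (B * ?q) powr p * measure N (space N)"
        unfolding I_def by (rule integral_norm_powr_bounds(1)[OF meas p sup])
      also have "\<dots> \<le> (B * ?q) powr p * (W * ?S)"
      proof (intro mult_left_mono)
        have "measure N (space N) \<le> D (CARD('n) + 2) * v * 2 ^ (CARD('n) + 2) * ?S" using Nw(2) unfolding q .
        also have "\<dots> \<le> W * ?S" unfolding W_def using v by (intro mult_right_mono) auto
        finally show "measure N (space N) \<le> W * ?S" .
      qed simp
      finally show ?thesis using Bb by (simp add: powr_mult mult_ac)
    qed
    have Izero: "I c = 0" if "c \<in> \<Theta>" "c \<notin> active_caps \<sigma> R \<Theta>" for c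
      using p by (simp add: I_def capped_inactive[OF that] extension_zero)
    have Ilower: "b powr p * (\<kappa> ^ (CARD('n) + 1) * v / A) * (?q powr p * ?S) \<le> I c" if c: "c \<in> heavy_caps \<sigma> R \<Theta>" for c
    proof -
      have "b * ?q \<le> (LINT \<xi>|surface_measure. capped \<sigma> R c \<xi>) / 2"
        using c unfolding heavy_caps_def q b_def by simp
      then have ge: "b * ?q \<le> norm (extension (capped \<sigma> R c) x)" if "x \<in> ball 0 (\<kappa> * R)" for x
        using norm_extension_capped_ge[OF R \<sigma>(2), of x c] that by (simp add: \<kappa>_def)
      have "(b * ?q) powr p * ((\<kappa> * R) ^ (CARD('n) + 1) * v / A) \<le> (b * ?q) powr p * measure N (ball 0 (\<kappa> * R))"
        using Nw(3)[of "\<kappa> * R"] \<kappa> R by (intro mult_left_mono) auto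
      also have "\<dots> \<le> I c"
        unfolding I_def using Bb by (intro integral_norm_powr_bounds(2)[OF meas p sup] ge) (auto simp: N_def)
      finally show ?thesis using Bb by (simp add: powr_mult power_mult_distrib mult_ac q(3)[symmetric])
    qed
    let ?T = "R powr (?n * \<sigma>) * (?q powr p * ?S)"
    let ?Z = "b powr p * (\<kappa> ^ (CARD('n) + 1) * v / A) * (?q powr p * ?S)"
    have T: "R powr (?n * \<sigma> - ?n * p + (?n + 1)) = ?T"
      by (simp add: powr_powr powr_add[symmetric] algebra_simps)
    note D = wave_packet_systemD(1,2)[OF sys]
    note ac = active_caps_bound[OF D(1) R \<sigma>(1)]
    have "(\<Sum>c\<in>\<Theta>. I c) = (\<Sum>c\<in>active_caps \<sigma> R \<Theta>. I c)"
      using Izero fin by (intro sum.mono_neutral_right) (auto simp: active_caps_def)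
    also have "\<dots> \<le> real (card (active_caps \<sigma> R \<Theta>)) * (B powr p * W * (?q powr p * ?S))"
      using Iupper by (rule sum_bounded_above)
    also have "\<dots> \<le> (4 ^ CARD('n) * R powr (?n * \<sigma>)) * (B powr p * W * (?q powr p * ?S))"
      using ac W by (intro mult_right_mono) auto
    finally have upper: "(\<Sum>c\<in>\<Theta>. I c) \<le> C1 * ?T" by (simp add: C1_def mult_ac)
    have "R powr (?n * \<sigma>) / 14 ^ CARD('n) \<le> real (card (heavy_caps \<sigma> R \<Theta>))"
      using heavy_caps_bound[OF D R \<sigma> fin] by (simp add: field_simps)
    moreover have "0 \<le> ?Z" using Bb \<kappa> v A by simp
    ultimately have "R powr (?n * \<sigma>) / 14 ^ CARD('n) * ?Z \<le> real (card (heavy_caps \<sigma> R \<Theta>)) * ?Z"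
      by (rule mult_right_mono)
    moreover have "c2 * ?T = R powr (?n * \<sigma>) / 14 ^ CARD('n) * ?Z" by (simp add: c2_def mult_ac)
    ultimately have "c2 * ?T \<le> real (card (heavy_caps \<sigma> R \<Theta>)) * ?Z" by simp
    also have "\<dots> \<le> (\<Sum>c\<in>heavy_caps \<sigma> R \<Theta>. I c)" using Ilower by (rule sum_bounded_below)
    also have "\<dots> \<le> (\<Sum>c\<in>\<Theta>. I c)"
      using fin I0 by (intro sum_mono2) (auto simp: heavy_caps_def)
    finally have lower: "c2 * ?T \<le> (\<Sum>c\<in>\<Theta>. I c)" .
    show ?thesis
      unfolding N_def[symmetric] sum_eq T using upper lower c2 I0 by (intro comparableI_bounds) (auto intro: sum_nonneg)
  qed
  then show ?thesis using c2 by (intro exI[of _ "max C1 (1 / c2)"]) (auto simp: less_max_iff_disj)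
qed

text \<open>C depends on the dimension, \<sigma>, p, A and D, and is chosen before R, the
  decomposition and the weight. It serves all \<epsilon> at once because R^\<epsilon> is an exact
  factor of the right hand side. Taking M least makes its size a property of the packets of g
  instead of the choice of a bound.\<close>

theorem mainTheorem1:
  fixes \<sigma> A p :: real and D :: "nat \<Rightarrow> real" and d :: nat
  assumes "d = CARD('n::finite) + 1"
    and "0 < \<sigma>" and "\<sigma> < 1 / 2"
    and "p = 2 * (real d + 1) / (real d - 1)"
    and "A \<ge> 1"
  shows "\<exists>C>0. \<forall>R>1.
    \<forall>(\<Theta> :: (real ^ 'n) set) U V \<eta> w.
      wave_packet_system A D R \<Theta> U V \<eta> \<and> ball_weight A D R w \<longrightarrow>
      (let g = (g_fun \<sigma> R :: 'n pt \<Rightarrow> complex);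
           X = (X_set \<sigma> R :: 'n pt set);
           hit = hits_at_most (packets_hit (h_fun \<sigma> R) A R \<Theta> U V \<eta>) X;
           M = (LEAST m. hit m);
           g_norm = Lp_norm p (restrict_space lborel X) g;
           rhs = (\<lambda>\<epsilon>. decoupling_rhs \<epsilon> p R M \<Theta> w (cap_part (h_fun \<sigma> R) R V \<eta>));
           e = (real d - 1) / 2 * \<sigma> - (real d - 1) * (real d + 2) / (2 * (real d + 1))
       in finite \<Theta> \<and>
          hit M \<and>
          comparable C (real M) (R powr ((real d - 1) * \<sigma>)) \<and>
          comparable C g_norm (R powr ((real d - 1) * (\<sigma> - 1)) * measure lborel X powr (1 / p)) \<and>
          comparable C (R powr ((real d - 1) * (\<sigma> - 1)) * measure lborel X powr (1 / p)) (R powr e) \<and>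
          (\<forall>\<epsilon>>0. comparable C (rhs \<epsilon>) (R powr (e + \<epsilon>)) \<and>
                 comparable C (rhs \<epsilon>) (R powr \<epsilon> * g_norm)))"
proof -
  let ?n = "real CARD('n)"
  have n: "?n > 0" by simp
  have A: "A > 0" using assms(5) by simp
  have d: "real d - 1 = ?n" "real d + 1 = ?n + 2" "real d + 2 = ?n + 3" using assms(1) by auto
  have p_eq: "p = 2 * (?n + 2) / ?n" using assms(4) unfolding d .
  then have p: "p > 0" using n by simp
  define e where "e = ?n / 2 * \<sigma> - ?n * (?n + 3) / (2 * (?n + 2))"
  define q where "q = 1 / 2 - 1 / p"
  have p1: "1 / p = ?n / (2 * (?n + 2))" using n by (simp add: p_eq)
  have q: "q = 1 / (?n + 2)" unfolding q_def p1 by (simp add: field_simps)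
  have e1: "?n * (\<sigma> - 1) + (?n * (1 - \<sigma>) + (1 - 2 * \<sigma>)) * (1 / p) = e"
    unfolding e_def p1 by (simp add: field_simps)
  \<comment> \<open>The powers of R^\<sigma> come from M with exponent n q and from the number of
    caps with exponent n / p. Since q + 1 / p = 1/2, they add up to n / 2.\<close>
  have e2: "?n * \<sigma> * q + (?n * \<sigma> - ?n * p + (?n + 1)) * (1 / p) = e"
  proof -
    have *: "(?n * \<sigma> - ?n * p + (?n + 1)) * (1 / p) = (?n * \<sigma> + ?n + 1) * (1 / p) - ?n"
      using p by (simp add: diff_divide_distrib add_divide_distrib)
    \<comment> \<open>With t = n + 2 the denominators become monomials, and clearing them leaves a
      polynomial identity.\<close>
    obtain t where t: "?n = t - 2" "t > 0" using n by (metis add_diff_cancel_right' add_pos_pos zero_less_numeral)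
    show ?thesis unfolding * unfolding e_def q p1 t(1) using t(2) by (simp add: field_simps)
  qed
  obtain CX where CX: "CX > 0" "\<And>R. R > 1 \<Longrightarrow> comparable CX (measure lborel (X_set \<sigma> R :: 'n pt set))
    (R powr (?n * (1 - \<sigma>) + (1 - 2 * \<sigma>)))"
    using measure_and_norm_on_X_set_comparable(1)[OF assms(2,3) p, where 'n = 'n] by blast
  obtain Cg where Cg: "Cg > 0" "\<And>R. R > 1 \<Longrightarrow> comparable Cg
      (Lp_norm p (restrict_space lborel (X_set \<sigma> R)) (g_fun \<sigma> R :: 'n pt \<Rightarrow> complex))
      (R powr (?n * (\<sigma> - 1)) * measure lborel (X_set \<sigma> R :: 'n pt set) powr (1 / p))"
    using measure_and_norm_on_X_set_comparable(2)[OF assms(2,3) p, where 'n = 'n] by blast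
  obtain CS where CS: "CS > 0" "\<And>R (\<Theta> :: (real ^ 'n) set) U V \<eta> w. R > 1 \<Longrightarrow> wave_packet_system A D R \<Theta> U V \<eta> \<Longrightarrow>
      ball_weight A D R w \<Longrightarrow>
      comparable CS (\<Sum>c\<in>\<Theta>. Lp_norm p (density lborel (\<lambda>x. ennreal (w x))) (cap_part (h_fun \<sigma> R) R V \<eta> c) powr p)
      (R powr (?n * \<sigma> - ?n * p + (?n + 1)))"
    using sum_cap_norms_comparable[OF assms(2,3) A p, where 'n = 'n and D = D] by blast
  define CM :: real where "CM = 14 ^ CARD('n)"
  define C3 where "C3 = CX powr (1 / p)"
  define C4 where "C4 = CM powr q * CS powr (1 / p)"
  have pos: "CM > 0" "C3 > 0" "C4 > 0" using CX CS by (auto simp: CM_def C3_def C4_def)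
  \<comment> \<open>A sum of positive constants dominates each of them; the last summand belongs to
    the chain that compares both sides of the inequality.\<close>
  define C where "C = CM + Cg + C3 + C4 + C4 * (C3 * Cg)"
  have C: "CM \<le> C" "Cg \<le> C" "C3 \<le> C" "C4 \<le> C" "C4 * (C3 * Cg) \<le> C" "C > 0"
    using pos Cg(1) by (auto simp: C_def intro!: add_nonneg_nonneg add_pos_pos)
  show ?thesis
    unfolding Let_def d e_def[symmetric]
  proof (intro exI[of _ C] conjI allI impI C; elim conjE)
    fix R :: real and \<Theta> :: "(real ^ 'n) set" and U V \<eta> and w :: "'n pt \<Rightarrow> real"
    assume R: "1 < R" and sys: "wave_packet_system A D R \<Theta> U V \<eta>" and w: "ball_weight A D R w"
    let ?hit = "hits_at_most (packets_hit (h_fun \<sigma> R) A R \<Theta> U V \<eta>) (X_set \<sigma> R)"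
    let ?M = "LEAST m. ?hit m"
    let ?g = "Lp_norm p (restrict_space lborel (X_set \<sigma> R)) (g_fun \<sigma> R :: 'n pt \<Rightarrow> complex)"
    let ?G = "R powr (?n * (\<sigma> - 1)) * measure lborel (X_set \<sigma> R :: 'n pt set) powr (1 / p)"
    let ?rhs = "\<lambda>\<epsilon>. decoupling_rhs \<epsilon> p R ?M \<Theta> w (cap_part (h_fun \<sigma> R) R V \<eta>)"
    let ?S = "\<Sum>c\<in>\<Theta>. Lp_norm p (density lborel (\<lambda>x. ennreal (w x))) (cap_part (h_fun \<sigma> R) R V \<eta> c) powr p"
    note M = least_hits_bounds[OF sys R assms(2,3) A]
    have g0: "?g \<ge> 0" by (simp add: Lp_norm_def)
    have S0: "?S \<ge> 0" by (intro sum_nonneg) simp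
    have rhs0: "?rhs \<epsilon> \<ge> 0" for \<epsilon> by (simp add: decoupling_rhs_def)
    show "finite \<Theta>" using finite_caps[OF sys] R by simp
    show "?hit ?M" by (rule M(1))
    have kM: "comparable CM (real ?M) (R powr (?n * \<sigma>))" unfolding CM_def by (rule M(2))
    then show "comparable C (real ?M) (R powr (?n * \<sigma>))" using C(1) by (rule comparable_mono) auto
    have kg: "comparable Cg ?g ?G" by (rule Cg(2)[OF R])
    then show "comparable C ?g ?G" using C(2) g0 by (rule comparable_mono) auto
    \<comment> \<open>Exact factors enter the product rule with constant 1.\<close>
    have k1: "comparable 1 a a" if "0 \<le> a" for a :: real using that by (simp add: comparable_def)
    have "comparable (1 * C3) ?G (R powr (?n * (\<sigma> - 1)) * (R powr (?n * (1 - \<sigma>) + (1 - 2 * \<sigma>))) powr (1 / p))"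
      unfolding C3_def using CX(1) p by (intro comparable_mult comparable_powr CX(2)[OF R] k1) auto
    moreover have "R powr (?n * (\<sigma> - 1)) * (R powr (?n * (1 - \<sigma>) + (1 - 2 * \<sigma>))) powr (1 / p) = R powr e"
      unfolding powr_powr powr_add[symmetric] e1 ..
    ultimately have kG: "comparable C3 ?G (R powr e)" by simp
    then show "comparable C ?G (R powr e)" using C(3) by (rule comparable_mono) auto
    fix \<epsilon> :: real assume "0 < \<epsilon>"
    have "comparable (1 * CM powr q * CS powr (1 / p)) (?rhs \<epsilon>)
        (R powr \<epsilon> * (R powr (?n * \<sigma>)) powr q * (R powr (?n * \<sigma> - ?n * p + (?n + 1))) powr (1 / p))"
      unfolding decoupling_rhs_def q_def[symmetric]
      using CS(1) p pos q n S0
      by (intro comparable_mult comparable_powr kM CS(2)[OF R sys w] k1) auto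
    moreover have "R powr \<epsilon> * (R powr (?n * \<sigma>)) powr q * (R powr (?n * \<sigma> - ?n * p + (?n + 1))) powr (1 / p) = R powr (e + \<epsilon>)"
      unfolding powr_powr powr_add[symmetric] e2[symmetric] by (simp add: algebra_simps)
    ultimately have krhs: "comparable C4 (?rhs \<epsilon>) (R powr (e + \<epsilon>))" by (simp add: C4_def)
    then show "comparable C (?rhs \<epsilon>) (R powr (e + \<epsilon>))" using C(4) rhs0 by (rule comparable_mono) auto
    \<comment> \<open>The two sides are compared through R^e: the norm of g is comparable to
      \<open>?G\<close>, \<open>?G\<close> to R^e, and the right hand side to R^(e +
      \<epsilon>).\<close>
    have "comparable (C3 * Cg) (R powr e) ?g"
      using kG kg pos Cg(1) by (intro comparable_trans[of C3 _ ?G]) (auto simp: comparable_sym)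
    then have "comparable (1 * (C3 * Cg)) (R powr \<epsilon> * R powr e) (R powr \<epsilon> * ?g)"
      using g0 by (intro comparable_mult k1) auto
    then have "comparable (C3 * Cg) (R powr (e + \<epsilon>)) (R powr \<epsilon> * ?g)"
      by (simp add: powr_add mult.commute)
    then have "comparable (C4 * (C3 * Cg)) (?rhs \<epsilon>) (R powr \<epsilon> * ?g)"
      by (rule comparable_trans[OF krhs]) (use pos Cg(1) in auto)
    then show "comparable C (?rhs \<epsilon>) (R powr \<epsilon> * ?g)" using C(5) rhs0 g0 by (intro comparable_mono[OF _ C(5)]) auto
  qed
qed

end
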